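(* Let $\lambda>\frac1e$ be real and $E_\lambda(z)=\lambda e^z$. Let $t_0,t_1,\ldots$ be a sequence of finite blocks (finite sequences) of integers such that for every $m\in\mathbb{N}$ at least one term of the block $t_m$ is non-zero. Then there exists a sequence of natural numbers $(n_q)_{q\in\mathbb{N}}$ such that, if $s$ is the infinite sequence obtained by concatenation $$s=0_{n_0}t_00_{n_1}t_10_{n_2}t_2\ldots,$$ then $I_s\cup\{\infty\}=\overline{\gamma_s}\cup\{\infty\}=A(\gamma_s)$, and $I_s\cup\{\infty\}$ is an indecomposable continuum in the Riemann sphere $\widehat{\mathbb{C}}=\mathbb{C}\cup\{\infty\}$.
   Context: $\mathbb{N}=\{0,1,2,\ldots\}$. $0_k$ denotes the block consisting of $k$ zeros, $k\in\mathbb{N}$. For $j\in\mathbb{Z}$ let $R_j=\{z\in\mathbb{C}:(2j-1)\pi<\operatorname{Im}(z)\le(2j+1)\pi\}$. For $s=(s_0s_1\ldots)\in\mathbb{Z}^{\mathbb{N}}$ let $I_s=\{z\in\mathbb{C}: E_\lambda^j(z)\in R_{s_j}\text{ for all } j\in\mathbb{N}\}$, where $E_\lambda^j$ is the $j$-th iterate. A sequence $s$ is exponentially bounded if there are $A,x>0$ with $|s_k|<AF^k(x)$ for all $k\in\mathbb{N}$, where $F(t)=e^t-1$ and $F^k$ is its $k$-th iterate. For an exponentially bounded $s$ that does not end with an infinite sequence of zeros, let $\Gamma_s=\{z\in I_s:E_\lambda^n(z)\to\infty\text{ as } n\to\infty\}$. It is known (Schleicher--Zimmer) that $\Gamma_s$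 is the image of an injective continuous curve $\psi:(0,+\infty)\to\mathbb{C}$ or $\psi:[0,+\infty)\to\mathbb{C}$ with $\lim_{\eta\to+\infty}\psi(\eta)=\infty$. In both cases the hair associated with $s$ is $\gamma_s=\psi|_{(0,+\infty)}$; the symbol $\gamma_s$ also denotes its image. An assertion about $\gamma_s$ includes the assertion that $s$ is exponentially bounded, so that $\gamma_s$ is defined. The accumulation set $A(\gamma_s)\subseteq\widehat{\mathbb{C}}$ is the set of all possible limits $\lim_{n\to\infty}\gamma_s(\eta_n)$ (in $\widehat{\mathbb{C}}$), where $\eta_n\to0$. $\overline{\gamma_s}$ is the closure in $\mathbb{C}$. An indecomposable continuum is a continuum that cannot be written as the union of two proper subcontinua. *)

theory Defs
  imports "HOL-Analysis.Analysis" "HOL-Library.Stream"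
begin

definition E :: "real \<Rightarrow> complex \<Rightarrow> complex" where
  "E lam z = of_real lam * exp z"

definition R :: "int \<Rightarrow> complex set" where
  "R j = {z. (2 * of_int j - 1) * pi < Im z \<and> Im z \<le> (2 * of_int j + 1) * pi}"

definition itin_set :: "real \<Rightarrow> (nat \<Rightarrow> int) \<Rightarrow> complex set" where
  "itin_set lam s = {z. \<forall>j. (E lam ^^ j) z \<in> R (s j)}"

definition exponentially_bounded :: "(nat \<Rightarrow> int) \<Rightarrow> bool" where
  "exponentially_bounded s \<longleftrightarrow>
     (\<exists>A>0. \<exists>x>0. \<forall>k. \<bar>real_of_int (s k)\<bar> < A * ((\<lambda>t::real. exp t - 1) ^^ k) x)"

definition escaping_set :: "real \<Rightarrow> (nat \<Rightarrow> int) \<Rightarrow> complex set" where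
  "escaping_set lam s =
     {z \<in> itin_set lam s. filterlim (\<lambda>n. (E lam ^^ n) z) at_infinity sequentially}"

text \<open>\<^term>\<open>is_hair lam s \<gamma>\<close>: the hair associated with \<^term>\<open>s\<close> is defined, and it is
  the restriction of \<^term>\<open>\<gamma>\<close> to the open half-line. In the first case below the escaping set
  is the hair itself, and the values of \<^term>\<open>\<gamma>\<close> outside the open half-line are irrelevant; in
  the second case the escaping set is the hair together with its endpoint \<^term>\<open>\<gamma> 0\<close>.
  Neither the image of the open half-line nor the accumulation set depends on which such
  \<^term>\<open>\<gamma>\<close> is used.\<close>

definition is_hair :: "real \<Rightarrow> (nat \<Rightarrow> int) \<Rightarrow> (real \<Rightarrow> complex) \<Rightarrow> bool" where
  "is_hair lam s \<gamma> \<longleftrightarrow>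
     exponentially_bounded s \<and> \<not> (\<forall>\<^sub>F k in sequentially. s k = 0) \<and>
     filterlim \<gamma> at_infinity at_top \<and>
     (continuous_on {0<..} \<gamma> \<and> inj_on \<gamma> {0<..} \<and> \<gamma> ` {0<..} = escaping_set lam s \<or>
      continuous_on {0..} \<gamma> \<and> inj_on \<gamma> {0..} \<and> \<gamma> ` {0..} = escaping_set lam s)"

text \<open>The Riemann sphere is the one-point compactification of the plane: \<^term>\<open>Some z\<close> is the
  finite point \<^term>\<open>z\<close>, and \<^term>\<open>None\<close> is \<open>\<infinity>\<close>.\<close>

definition riemann_sphere :: "complex option topology" where
  "riemann_sphere = Alexandroff_compactification euclidean"

definition with_infinity :: "complex set \<Rightarrow> complex option set" where
  "with_infinity S = insert None (Some ` S)"

definition accumulation_set :: "(real \<Rightarrow> complex) \<Rightarrow> complex option set" where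
  "accumulation_set \<gamma> =
     {l. \<exists>\<eta>. (\<forall>n. \<eta> n > 0) \<and> \<eta> \<longlonglongrightarrow> 0 \<and>
         limitin riemann_sphere (\<lambda>n. Some (\<gamma> (\<eta> n))) l sequentially}"

definition continuum_in :: "'a topology \<Rightarrow> 'a set \<Rightarrow> bool" where
  "continuum_in X K \<longleftrightarrow> K \<noteq> {} \<and> compactin X K \<and> connectedin X K"

definition indecomposable_continuum_in :: "'a topology \<Rightarrow> 'a set \<Rightarrow> bool" where
  "indecomposable_continuum_in X K \<longleftrightarrow> continuum_in X K \<and>
     \<not> (\<exists>A B. continuum_in X A \<and> continuum_in X B \<and> A \<subset> K \<and> B \<subset> K \<and> K = A \<union> B)"

text \<open>The sequence \<open>0\<^sub>n\<^sub>0 t\<^sub>0 0\<^sub>n\<^sub>1 t\<^sub>1 \<dots>\<close>; the function \<^const>\<open>flat\<close> concatenates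
  provided that all the blocks \<^term>\<open>t q\<close> are non-empty.\<close>

definition zero_padded_concat :: "(nat \<Rightarrow> nat) \<Rightarrow> (nat \<Rightarrow> int list) \<Rightarrow> nat \<Rightarrow> int" where
  "zero_padded_concat n t = snth (flat (smap (\<lambda>q. replicate (n q) 0 @ t q) nats))"

end

theory Submission
  imports Defs "HOL-Real_Asymp.Real_Asymp"
begin

text \<open>
  Write \<open>f = E\<^sub>\<lambda>\<close>, \<open>F t = e\<^sup>t - 1\<close>. If the blocks of zeros are so long that the entries of \<open>s\<close>,
  counted from the beginning of any block of zeros, grow at most linearly, then every potential
  \<open>\<eta> > 0\<close> belongs to exactly one \<open>z \<in> I\<^sub>s\<close> for which \<open>Re (f\<^sup>k z) - F\<^sup>k \<eta>\<close> stays bounded, and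
  all escaping points of \<open>I\<^sub>s\<close> arise in this way. Existence comes from pulling back the points
  \<open>F\<^sup>n \<eta> + 2 \<pi> i s\<^sub>n\<close> and compactness, uniqueness from the expansion of \<open>f\<close> far to the right.
  This is the hair, parametrised by the potential.

  The hair is dense in \<open>I\<^sub>s\<close>. If \<open>s\<^sub>k \<noteq> 0\<close> is followed by \<open>N\<close> zeros and an entry \<open>j \<noteq> 0\<close>, then a
  comparison with the real orbit of the singular value \<open>0\<close> shows that both the hair and \<open>I\<^sub>s\<close>
  at time \<open>k + 1\<close> approach \<open>0\<close> up to a distance comparable with \<open>\<bar>j\<bar> / (a\<^sub>1 \<cdots> a\<^sub>N)\<close>, where
  \<open>a\<^sub>i = f\<^sup>i 0\<close>. The hair is connected, hence at time \<open>k\<close> it is within bounded distance of every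
  point of \<open>I\<^sub>s\<close>; pulling back contracts the hyperbolic metric of the half-planes by at
  least \<open>1/2\<close> at every non-zero entry.

  For indecomposability, suppose that \<open>I\<^sub>s \<union> {\<infinity>} = A \<union> B\<close> properly, with \<open>\<infinity> \<in> A\<close>. Escaping points
  \<open>a \<notin> B\<close>, \<open>b \<notin> A\<close> exist, and by expansion for large \<open>k\<close> no point of \<open>B\<close> has
  \<open>Re f\<^sup>k = r = Re (f\<^sup>k a)\<close> and no point of \<open>A\<close> has \<open>Re f\<^sup>k = r' = Re (f\<^sup>k b)\<close>. Connectedness
  forces \<open>Re f\<^sup>k > r'\<close> on \<open>A\<close> and \<open>Re f\<^sup>k < r\<close> on \<open>B\<close>, and then \<open>Re f\<^sup>k\<^sup>+\<^sup>1 > 0\<close> on \<open>A\<close>. A point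
  with \<open>Re f\<^sup>k\<^sup>+\<^sup>1 < - \<lambda> e\<^sup>r\<close>, which exists in front of a sufficiently long block of zeros, lies in
  neither set. Finally, the hair splits \<open>I\<^sub>s \<union> {\<infinity>}\<close> into the closure of an initial piece and a
  closed arc ending at \<open>\<infinity>\<close>, so by indecomposability every initial piece is dense.
\<close>

section \<open>Itineraries and inverse branches\<close>

definition shift_seq :: "nat \<Rightarrow> (nat \<Rightarrow> int) \<Rightarrow> nat \<Rightarrow> int" where
  "shift_seq k s = (\<lambda>j. s (k + j))"

text \<open>Non-zero entries at arbitrarily late times keep an orbit off the real axis forever; see
  \<open>cR_orbit_nonreal\<close>.\<close>

definition nonzero_often :: "(nat \<Rightarrow> int) \<Rightarrow> bool" where
  "nonzero_often s \<longleftrightarrow> (\<forall>m. \<exists>k\<ge>m. s k \<noteq> 0)"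

text \<open>Closing the strips makes the conditions in the compactness arguments closed;
  \<open>itin_iff_cR\<close> recovers the half-open strips.\<close>

definition closed_R :: "int \<Rightarrow> complex set" where
  "closed_R j = {z. (2 * of_int j - 1) * pi \<le> Im z \<and> Im z \<le> (2 * of_int j + 1) * pi}"

lemma shift_apply: "shift_seq k s j = s (k + j)"
  by (simp add: shift_seq_def)

lemma shift_shift [simp]: "shift_seq k (shift_seq l s) = shift_seq (l + k) s"
  by (simp add: shift_seq_def add_ac)

lemma shift_0 [simp]: "shift_seq 0 s = s"
  by (simp add: shift_seq_def)

lemma rec_nz_shift: "nonzero_often s \<Longrightarrow> nonzero_often (shift_seq k s)"
  unfolding nonzero_often_def shift_apply
  by (metis add_le_cancel_left le_add1 le_add_diff_inverse order_trans)

lemma R_subset_cR: "R j \<subseteq> closed_R j"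
  by (auto simp: R_def closed_R_def)

lemma closed_cR: "closed (closed_R j)"
proof -
  have "closed_R j = {z. (2 * of_int j - 1) * pi \<le> Im z} \<inter> {z. Im z \<le> (2 * of_int j + 1) * pi}"
    by (auto simp: closed_R_def)
  then show ?thesis
    by (simp add: closed_Int closed_halfspace_Im_ge closed_halfspace_Im_le)
qed

lemma cR_abs_Im:
  assumes "z \<in> closed_R j"
  shows "\<bar>Im z\<bar> \<le> (2 * \<bar>real_of_int j\<bar> + 1) * pi" "\<bar>Im z\<bar> \<ge> (2 * \<bar>real_of_int j\<bar> - 1) * pi"
proof -
  define J where "J = real_of_int j * pi"
  have a: "2 * J - pi \<le> Im z" "Im z \<le> 2 * J + pi"
    using assms by (simp_all add: closed_R_def J_def algebra_simps)
  have b: "(2 * \<bar>real_of_int j\<bar> + 1) * pi = 2 * \<bar>J\<bar> + pi" "(2 * \<bar>real_of_int j\<bar> - 1) * pi = 2 * \<bar>J\<bar> - pi"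
    by (simp_all add: J_def abs_mult algebra_simps)
  show "\<bar>Im z\<bar> \<le> (2 * \<bar>real_of_int j\<bar> + 1) * pi" "\<bar>Im z\<bar> \<ge> (2 * \<bar>real_of_int j\<bar> - 1) * pi"
    unfolding b using a pi_gt_zero by arith+
qed

lemma real_in_cR:
  assumes "z \<in> closed_R j" "Im z = 0"
  shows "j = 0"
proof (rule ccontr)
  assume "j \<noteq> 0"
  then have "\<bar>real_of_int j\<bar> \<ge> 1" by linarith
  then have "(2 * \<bar>real_of_int j\<bar> - 1) * pi > 0" by simp
  with cR_abs_Im(2)[OF assms(1)] assms(2) show False by simp
qed

lemma cR_diff_Im: "z \<in> closed_R j \<Longrightarrow> w \<in> closed_R j \<Longrightarrow> \<bar>Im z - Im w\<bar> \<le> 2 * pi"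
  by (auto simp: closed_R_def algebra_simps abs_le_iff)

section \<open>Iterates of the exponential map and inverse branches along an itinerary\<close>

locale expo =
  fixes lam :: real
  assumes lam_gt: "lam > 1 / exp 1"
begin

abbreviation "f \<equiv> E lam"
abbreviation "itin \<equiv> itin_set lam"
abbreviation "Esc \<equiv> escaping_set lam"

lemma lam_third: "lam > 1/3"
proof -
  have "exp (1::real) \<le> 3" using exp_le by simp
  then have "1 / 3 \<le> 1 / exp (1::real)" by (simp add: frac_le)
  then show ?thesis using lam_gt by linarith
qed

lemma lam_pos [simp]: "lam > 0" "0 \<le> lam" "lam \<noteq> 0" using lam_third by auto

lemma f_nonzero [simp]: "f z \<noteq> 0" by (simp add: E_def)
lemma norm_f: "norm (f z) = lam * exp (Re z)" by (simp add: E_def norm_mult)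
lemma Im_f: "Im (f z) = lam * exp (Re z) * sin (Im z)" by (simp add: E_def Im_exp)
lemma continuous_f: "continuous_on A f"
  unfolding E_def by (intro continuous_intros)

lemma continuous_funpow_f: "continuous_on A (f ^^ n)"
proof (induction n arbitrary: A)
  case (Suc n)
  then show ?case
    by (simp only: funpow.simps) (intro continuous_on_compose continuous_f Suc)
qed simp

lemma funpow_f_add: "(f ^^ (m + n)) z = (f ^^ n) ((f ^^ m) z)"
  by (subst add.commute) (simp add: funpow_add)

lemma funpow_f_Suc: "(f ^^ Suc n) z = (f ^^ n) (f z)"
  by (simp add: funpow_swap1)

lemma exp_2pi_int: "exp (of_real (2 * pi * of_int j) * \<i>) = (1::complex)"
  by (auto simp: exp_eq_1)

text \<open>The inverse of \<open>f\<close> with values in \<open>R j\<close>. The principal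
  logarithm has imaginary part greater than -\<pi> and at most \<pi>, which matches the half-open
  strips exactly.\<close>

definition branch :: "int \<Rightarrow> complex \<Rightarrow> complex" where
  "branch j w = Ln (w / of_real lam) + of_real (2 * pi * of_int j) * \<i>"

lemma f_Lb: assumes "w \<noteq> 0" shows "f (branch j w) = w"
proof -
  show ?thesis using assms exp_2pi_int[of j] by (simp add: E_def branch_def exp_add)
qed

lemma Im_Lb: "Im (branch j w) = Im (Ln (w / of_real lam)) + 2 * pi * of_int j"
  by (simp add: branch_def)

lemma Re_Lb: "w \<noteq> 0 \<Longrightarrow> Re (branch j w) = ln (norm w / lam)"
  by (simp add: branch_def norm_divide)

lemma Lb_in_R: "w \<noteq> 0 \<Longrightarrow> branch j w \<in> R j"
  using mpi_less_Im_Ln[of "w / of_real lam"] Im_Ln_le_pi[of "w / of_real lam"]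
  by (simp add: R_def Im_Lb algebra_simps)

lemma Lb_f: assumes "z \<in> R j" shows "branch j (f z) = z"
proof -
  have "Ln (exp z) = Ln (exp (z - of_real (2 * pi * of_int j) * \<i>))"
  proof -
    show ?thesis using exp_2pi_int[of j] by (simp add: exp_diff)
  qed
  also have "\<dots> = z - of_real (2 * pi * of_int j) * \<i>"
    by (rule Ln_exp) (use assms in \<open>auto simp: R_def algebra_simps\<close>)
  finally show ?thesis by (simp add: branch_def E_def)
qed

lemma f_inj_R: "z \<in> R j \<Longrightarrow> w \<in> R j \<Longrightarrow> f z = f w \<Longrightarrow> z = w"
  by (metis Lb_f)

lemma all_nat_split_Suc: "(\<forall>j. P j) \<longleftrightarrow> P 0 \<and> (\<forall>j. P (Suc j))"
  using not0_implies_Suc by metis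

lemma itin_Suc: "z \<in> itin s \<longleftrightarrow> z \<in> R (s 0) \<and> f z \<in> itin (shift_seq 1 s)"
proof -
  have "(\<forall>j. (f ^^ j) z \<in> R (s j)) \<longleftrightarrow> z \<in> R (s 0) \<and> (\<forall>j. (f ^^ Suc j) z \<in> R (s (Suc j)))"
    by (subst all_nat_split_Suc) simp
  then show ?thesis by (simp add: itin_set_def funpow_swap1 shift_apply)
qed

lemma itin_funpow: "z \<in> itin s \<Longrightarrow> (f ^^ k) z \<in> itin (shift_seq k s)"
  by (auto simp: itin_set_def shift_apply simp flip: funpow_f_add)

lemma itin_R: "z \<in> itin s \<Longrightarrow> (f ^^ k) z \<in> R (s k)"
  by (simp add: itin_set_def)

lemma itin_cR: "z \<in> itin s \<Longrightarrow> (f ^^ k) z \<in> closed_R (s k)"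
  using itin_R R_subset_cR by blast

lemma itin_inj: "z \<in> itin s \<Longrightarrow> w \<in> itin s \<Longrightarrow> (f ^^ k) z = (f ^^ k) w \<Longrightarrow> z = w"
proof (induction k arbitrary: z w s)
  case (Suc k)
  have "f z = f w"
    using Suc.prems(3) by (intro Suc.IH[of "f z" "shift_seq 1 s" "f w"] itin_Suc[THEN iffD1, THEN conjunct2] Suc.prems(1,2))
      (simp only: funpow_f_Suc)
  then show ?case using Suc.prems(1,2) f_inj_R itin_Suc by blast
qed simp

lemma Lb_itin: "w \<noteq> 0 \<Longrightarrow> w \<in> itin (shift_seq 1 s) \<Longrightarrow> branch (s 0) w \<in> itin s"
  by (subst itin_Suc) (simp add: f_Lb Lb_in_R)

lemma funpow_real: "Im z = 0 \<Longrightarrow> Im ((f ^^ n) z) = 0"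
  by (induction n) (auto simp: Im_f)

text \<open>The real axis is forward invariant and meets only the closed strip of index 0, so a real
  orbit point would contradict the next non-zero entry.\<close>

lemma cR_orbit_nonreal:
  assumes "nonzero_often s" "\<And>j. (f ^^ j) z \<in> closed_R (s j)"
  shows "Im ((f ^^ j) z) \<noteq> 0"
proof
  assume 0: "Im ((f ^^ j) z) = 0"
  obtain k where k: "k \<ge> j" "s k \<noteq> 0" using assms(1) nonzero_often_def by blast
  have "Im ((f ^^ k) z) = 0"
    using funpow_real[OF 0, of "k - j"] k(1) by (simp flip: funpow_f_add)
  then show False using real_in_cR[OF assms(2)] k by blast
qed

text \<open>An orbit point on the lower edge of its strip has a real image, since the sine vanishes
  there, and \<open>cR_orbit_nonreal\<close> rules this out.\<close>

lemma itin_iff_cR: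
  assumes "nonzero_often s"
  shows "z \<in> itin s \<longleftrightarrow> (\<forall>j. (f ^^ j) z \<in> closed_R (s j))"
proof
  assume *: "\<forall>j. (f ^^ j) z \<in> closed_R (s j)"
  have "(f ^^ j) z \<in> R (s j)" for j
  proof (rule ccontr)
    assume "(f ^^ j) z \<notin> R (s j)"
    with * have "Im ((f ^^ j) z) = (2 * of_int (s j) - 1) * pi"
      unfolding closed_R_def R_def by (smt (verit, best) mem_Collect_eq)
    then have "Im ((f ^^ Suc j) z) = 0"
      using sin_zero_iff_int2[of "(2 * real_of_int (s j) - 1) * pi"]
      by (simp add: Im_f) (metis of_int_1 of_int_diff of_int_mult of_int_numeral)
    then show False using cR_orbit_nonreal[OF assms] * by blast
  qed
  then show "z \<in> itin s" by (simp add: itin_set_def)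
qed (simp add: itin_cR)

lemma itin_nonreal: "nonzero_often s \<Longrightarrow> z \<in> itin s \<Longrightarrow> Im z \<noteq> 0"
  using cR_orbit_nonreal[of s z 0] itin_cR by auto

lemma itin_nonzero: "nonzero_often s \<Longrightarrow> z \<in> itin s \<Longrightarrow> z \<noteq> 0"
  using itin_nonreal by fastforce

lemma closed_itin:
  assumes "nonzero_often s" shows "closed (itin s)"
proof -
  have "itin s = (\<Inter>j. (f ^^ j) -` closed_R (s j))"
    using itin_iff_cR[OF assms] by auto
  moreover have "closed ((f ^^ j) -` closed_R (s j))" for j
    using closed_vimage[OF closed_cR] continuous_funpow_f by blast
  ultimately show ?thesis by auto
qed

text \<open>Pulling back one entry at a time never meets the singular value 0, because points with
  such itineraries are not real.\<close>

lemma itin_surj: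
  assumes "nonzero_often s" "w \<in> itin (shift_seq k s)"
  shows "\<exists>z\<in>itin s. (f ^^ k) z = w"
  using assms
proof (induction k arbitrary: s)
  case (Suc k)
  obtain y where y: "y \<in> itin (shift_seq 1 s)" "(f ^^ k) y = w"
    using Suc.IH[of "shift_seq 1 s"] Suc.prems rec_nz_shift by auto
  have "y \<noteq> 0" using itin_nonzero[OF rec_nz_shift y(1)] Suc.prems(1) by simp
  then show ?case
    using Lb_itin[OF _ y(1)] f_Lb y(2) funpow_f_Suc by metis
qed auto

end

section \<open>Points of prescribed potential\<close>

definition F :: "real \<Rightarrow> real" where "F t = exp t - 1"

lemma F_funpow_Suc: "(F ^^ Suc n) t = (F ^^ n) (F t)"
  by (simp add: funpow_swap1)

lemma F_ge: "t \<ge> 2 \<Longrightarrow> F t \<ge> t + 1"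
  using exp_lower_Taylor_quadratic[of t] mult_right_mono[of 2 t t]
  unfolding F_def power2_eq_square by linarith

lemma F_funpow_ge: "t \<ge> 2 \<Longrightarrow> (F ^^ n) t \<ge> t + n"
proof (induction n)
  case (Suc n)
  then show ?case using F_ge[of "(F ^^ n) t"] by simp
qed simp

lemma continuous_F_funpow: "continuous_on A (F ^^ n)"
proof (induction n arbitrary: A)
  case (Suc n)
  have "continuous_on B F" for B unfolding F_def by (intro continuous_intros)
  then show ?case
    by (simp only: funpow.simps) (intro continuous_on_compose Suc)
qed simp

text \<open>The slope 1 is matched to \<open>F_ge\<close>: one iteration raises a potential of at
  least 2 by at least 1, just as one shift raises \<open>a\<close> by 1.\<close>

definition linearly_bounded :: "real \<Rightarrow> (nat \<Rightarrow> int) \<Rightarrow> bool" where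
  "linearly_bounded a s \<longleftrightarrow> a \<ge> 0 \<and> (\<forall>j. \<bar>real_of_int (s j)\<bar> \<le> a + real j)"

lemma S_class_shift: "linearly_bounded a s \<Longrightarrow> linearly_bounded (a + real k) (shift_seq k s)"
  by (auto simp: linearly_bounded_def shift_apply) (metis add.assoc of_nat_add)

section \<open>Constants and one-step estimates far to the right\<close>

context expo begin

text \<open>The error allowed between real parts and potentials: |ln lam| comes from the factor
  \<open>lam\<close>, and 1 leaves room for a factor 2 under the logarithm.\<close>

definition C1 :: real where "C1 = \<bar>ln lam\<bar> + 1"

lemma C1_ge: "C1 \<ge> 1" by (simp add: C1_def)

text \<open>At one large \<open>M\<close> the exponential exceeds the linear side with room to
  spare; the growth in \<open>b\<close> is absorbed by a factor 1 + b, which is paid for by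
  \<open>exp b\<close>. A single threshold thus serves all \<open>b\<close>.\<close>

lemma M_exists: "\<exists>M. M \<ge> C1 + 2 \<and> (\<forall>b\<ge>0. 4 * ((2 * b + 3) * pi + C1 + 1 + M + b) \<le> min 1 lam * exp (M + b))"
proof -
  have m: "min 1 lam > 0" using lam_pos by simp
  have "\<forall>\<^sub>F M in at_top. 4 * (3 * pi + 2 * pi + C1 + 2 + M) \<le> min 1 lam * exp M"
    using m by real_asymp
  moreover have "\<forall>\<^sub>F M in at_top. M \<ge> C1 + 2" by (rule eventually_ge_at_top)
  ultimately have "\<forall>\<^sub>F M in at_top. M \<ge> C1 + 2 \<and> 4 * (3 * pi + 2 * pi + C1 + 2 + M) \<le> min 1 lam * exp M"
    by eventually_elim auto
  then obtain M where M: "M \<ge> C1 + 2" "4 * (3 * pi + 2 * pi + C1 + 2 + M) \<le> min 1 lam * exp M"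
    using eventually_happens trivial_limit_at_top_linorder by blast
  have "4 * ((2 * b + 3) * pi + C1 + 1 + M + b) \<le> min 1 lam * exp (M + b)" if b: "b \<ge> 0" for b :: real
  proof -
    have "4 * ((2 * b + 3) * pi + C1 + 1 + M + b) \<le> 4 * (3 * pi + 2 * pi + C1 + 2 + M) * (1 + b)"
    proof -
      have "0 \<le> 3 * pi * b + 2 * pi + C1 * b + b + M * b + 1"
        using b M(1) C1_ge by simp
      then show ?thesis by (simp add: algebra_simps)
    qed
    also have "\<dots> \<le> (min 1 lam * exp M) * exp b"
    proof (rule mult_mono)
      show "1 + b \<le> exp b" by (rule exp_ge_add_one_self)
      show "0 \<le> min 1 lam * exp M" using m by (simp only: less_imp_le mult_nonneg_nonneg exp_ge_zero)
    qed (use M(2) b in simp_all)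
    finally show ?thesis by (simp add: exp_add mult_ac)
  qed
  with M(1) show ?thesis by blast
qed

definition M :: real where
  "M = (SOME M. M \<ge> C1 + 2 \<and> (\<forall>b\<ge>0. 4 * ((2 * b + 3) * pi + C1 + 1 + M + b) \<le> min 1 lam * exp (M + b)))"

lemma M_ge: "M \<ge> C1 + 2"
  and M_exp: "b \<ge> 0 \<Longrightarrow> 4 * ((2 * b + 3) * pi + C1 + 1 + M + b) \<le> min 1 lam * exp (M + b)"
  using someI_ex[OF M_exists] by (auto simp: M_def)

lemma M_ge3: "M \<ge> 3" using M_ge C1_ge by linarith

lemma ln_near:
  fixes B x :: real
  assumes "B > 0" "B / 2 \<le> x" "x \<le> 2 * B"
  shows "x > 0" "\<bar>ln x - ln B\<bar> \<le> 1"
proof -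
  show x: "x > 0" using assms by linarith
  have "ln x \<le> ln (2 * B)" "ln (B / 2) \<le> ln x" using assms x by simp_all
  moreover have "ln (2::real) \<le> 1" using ln_less_self[of 2] ln_2_less_1 by simp
  ultimately show "\<bar>ln x - ln B\<bar> \<le> 1" using assms(1) by (simp add: ln_mult ln_div)
qed

text \<open>By \<open>M_exp\<close> the imaginary part and the constants are small against
  \<open>exp y\<close>, so the modulus of \<open>w\<close> lies between exp y / 2 and 2 exp y. The
  error is again at most \<open>C1\<close>: errors do not accumulate under repeated
  pull-back.\<close>

lemma pull_back_step:
  assumes "b \<ge> 0" "y \<ge> M + b" "\<bar>Re w - F y\<bar> \<le> C1" "\<bar>Im w\<bar> \<le> (2 * b + 3) * pi"
  shows "w \<noteq> 0" "\<bar>ln (norm w / lam) - y\<bar> \<le> C1"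
proof -
  have "4 * ((2 * b + 3) * pi + C1 + 1 + M + b) \<le> 1 * exp (M + b)"
    by (rule order_trans[OF M_exp[OF assms(1)] mult_right_mono]) simp_all
  also have "\<dots> \<le> exp y" using assms(2) by simp
  finally have e: "4 * ((2 * b + 3) * pi + C1 + 1) \<le> exp y" using M_ge3 assms(1) by simp
  have p: "(2 * b + 3) * pi \<ge> 0" using assms(1) by simp
  have r: "Re w \<le> exp y - 1 + C1" "exp y - 1 - C1 \<le> Re w"
    using assms(3) unfolding F_def by linarith+
  then have "\<bar>Re w\<bar> \<le> exp y - 1 + C1" using e p C1_ge by (simp add: abs_if)
  then have 1: "norm w \<le> 2 * exp y"
    using cmod_le[of w] assms(4) e p C1_ge by (simp only: distrib_left)
  have "norm w \<ge> Re w" by (rule complex_Re_le_cmod)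
  then have 2: "exp y / 2 \<le> norm w" using r e p C1_ge by (simp only: distrib_left)
  note n = ln_near[OF exp_gt_zero 2 1]
  then show "w \<noteq> 0" by auto
  show "\<bar>ln (norm w / lam) - y\<bar> \<le> C1" using n by (simp add: ln_div C1_def)
qed

text \<open>The reverse comparison: \<open>ln (1 + y)\<close> is the inverse of \<open>F\<close> at
  \<open>y\<close>, and an error \<open>C1\<close> at the image yields the same error at
  \<open>z\<close>.\<close>

lemma push_step:
  assumes "b \<ge> 0" "Re z \<ge> M + b" "Re (f z) \<ge> 0" "\<bar>Im (f z)\<bar> \<le> (2 * b + 3) * pi"
    "\<bar>y - Re (f z)\<bar> \<le> C1"
  shows "\<bar>ln (1 + y) - Re z\<bar> \<le> C1" "1 + y > 0"
proof -
  define B where "B = norm (f z)"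
  have "4 * ((2 * b + 3) * pi + C1 + 1 + M + b) \<le> lam * exp (M + b)"
    by (rule order_trans[OF M_exp[OF assms(1)] mult_right_mono]) simp_all
  also have "\<dots> \<le> B" using assms(2) by (simp add: B_def norm_f)
  finally have e: "4 * ((2 * b + 3) * pi + C1 + 1) \<le> B" using M_ge3 assms(1) by simp
  have p: "(2 * b + 3) * pi \<ge> 0" using assms(1) by simp
  have "Re (f z) \<le> B" "B \<le> Re (f z) + \<bar>Im (f z)\<bar>"
    using cmod_le[of "f z"] complex_Re_le_cmod[of "f z"] assms(3) by (auto simp: B_def)
  moreover have "y \<le> Re (f z) + C1" "Re (f z) - C1 \<le> y" using assms(5) by linarith+
  ultimately have *: "B / 2 \<le> 1 + y" "1 + y \<le> 2 * B" "B > 0"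
    using assms(4) e p C1_ge by (simp_all only: distrib_left mult_1_right)+
  note n = ln_near[OF *(3,1,2)]
  then show "1 + y > 0" by simp
  have "ln B = ln lam + Re z" by (simp add: B_def norm_f ln_mult)
  then show "\<bar>ln (1 + y) - Re z\<bar> \<le> C1" using n by (simp add: C1_def)
qed

section \<open>Existence of points and of potentials by compactness\<close>

definition near :: "(nat \<Rightarrow> int) \<Rightarrow> real \<Rightarrow> complex \<Rightarrow> bool" where
  "near s \<eta> z \<longleftrightarrow> (\<forall>j. (f ^^ j) z \<in> closed_R (s j) \<and> \<bar>Re ((f ^^ j) z) - (F ^^ j) \<eta>\<bar> \<le> C1)"

lemma S_class_Im:
  assumes "linearly_bounded a s" "w \<in> closed_R (s 1)"
  shows "\<bar>Im w\<bar> \<le> (2 * a + 3) * pi"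
proof -
  have "\<bar>real_of_int (s 1)\<bar> \<le> a + 1" using assms(1) unfolding linearly_bounded_def by (metis of_nat_1)
  then have "(2 * \<bar>real_of_int (s 1)\<bar> + 1) * pi \<le> (2 * a + 3) * pi" by simp
  then show ?thesis using cR_abs_Im(1)[OF assms(2)] by linarith
qed

text \<open>The point with real part \<open>F^n \<eta>\<close> in the middle of the last strip is
  pulled back, by induction on \<open>n\<close> through the shifted sequence.\<close>

lemma near_finite:
  assumes "linearly_bounded a s" "\<eta> \<ge> M + a"
  shows "\<exists>z. \<forall>j\<le>n. (f ^^ j) z \<in> R (s j) \<and> \<bar>Re ((f ^^ j) z) - (F ^^ j) \<eta>\<bar> \<le> C1"
  using assms
proof (induction n arbitrary: s a \<eta>)
  case 0
  have "Complex \<eta> (2 * pi * of_int (s 0)) \<in> R (s 0)" by (simp add: R_def algebra_simps)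
  then show ?case using C1_ge by (intro exI[of _ "Complex \<eta> (2 * pi * of_int (s 0))"]) auto
next
  case (Suc n)
  have a: "a \<ge> 0" using Suc.prems by (simp add: linearly_bounded_def)
  have "\<eta> \<ge> 2" using Suc.prems(2) M_ge3 a by linarith
  \<comment> \<open>The shift raises \<open>a\<close> by 1, and \<open>F\<close> raises the
    potential by at least as much.\<close>
  then have "F \<eta> \<ge> M + (a + 1)" using F_ge Suc.prems(2) by force
  then obtain w where w: "\<forall>j\<le>n. (f ^^ j) w \<in> R (shift_seq 1 s j) \<and> \<bar>Re ((f ^^ j) w) - (F ^^ j) (F \<eta>)\<bar> \<le> C1"
    using Suc.IH[of "a + 1" "shift_seq 1 s" "F \<eta>"] S_class_shift[OF Suc.prems(1), of 1] by auto
  have w0: "w \<in> R (s 1)" "\<bar>Re w - F \<eta>\<bar> \<le> C1" using w[rule_format, of 0] by (auto simp: shift_apply)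
  have "\<bar>Im w\<bar> \<le> (2 * a + 3) * pi"
    using S_class_Im[OF Suc.prems(1)] w0(1) R_subset_cR by blast
  note st = pull_back_step[OF a Suc.prems(2) w0(2) this]
  show ?case
  proof (intro exI[of _ "branch (s 0) w"] allI impI)
    fix j assume j: "j \<le> Suc n"
    show "(f ^^ j) (branch (s 0) w) \<in> R (s j) \<and> \<bar>Re ((f ^^ j) (branch (s 0) w)) - (F ^^ j) \<eta>\<bar> \<le> C1"
    proof (cases j)
      case 0
      then show ?thesis using st by (simp add: Lb_in_R Re_Lb)
    next
      case (Suc i)
      then show ?thesis using w[rule_format, of i] j f_Lb[OF st(1)]
        by (simp add: shift_apply F_funpow_Suc funpow_f_Suc del: funpow.simps)
    qed
  qed
qed

lemma compact_strip_rect: "compact {z. \<bar>Re z - x\<bar> \<le> r \<and> z \<in> closed_R j}"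
proof -
  have "{z. \<bar>Re z - x\<bar> \<le> r \<and> z \<in> closed_R j} =
    cbox (Complex (x - r) ((2 * of_int j - 1) * pi)) (Complex (x + r) ((2 * of_int j + 1) * pi))"
    by (auto simp: in_cbox_complex_iff closed_R_def abs_le_iff)
  then show ?thesis by simp
qed

text \<open>The points of \<open>near_finite\<close> lie in nested compact sets: the rectangle of
  time 0, cut by the closed conditions up to time n.\<close>

lemma near_exists:
  assumes "linearly_bounded a s" "\<eta> \<ge> M + a"
  shows "\<exists>z. near s \<eta> z"
proof -
  define K where "K n = {z. \<bar>Re z - \<eta>\<bar> \<le> C1 \<and> z \<in> closed_R (s 0)} \<inter>
    (\<Inter>j\<in>{..n}. {z. (f ^^ j) z \<in> closed_R (s j)} \<inter> {z. \<bar>Re ((f ^^ j) z) - (F ^^ j) \<eta>\<bar> \<le> C1})" for n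
  have cl: "closed ({z. (f ^^ j) z \<in> closed_R (s j)} \<inter> {z. \<bar>Re ((f ^^ j) z) - (F ^^ j) \<eta>\<bar> \<le> C1})" for j
  proof (rule closed_Int)
    show "closed {z. (f ^^ j) z \<in> closed_R (s j)}"
      using closed_vimage[OF closed_cR] continuous_funpow_f by (auto simp: vimage_def)
    show "closed {z. \<bar>Re ((f ^^ j) z) - (F ^^ j) \<eta>\<bar> \<le> C1}"
      by (intro closed_Collect_le continuous_intros continuous_funpow_f)
  qed
  have "(\<Inter>n. K n) \<noteq> {}"
  proof (rule compact_nest)
    show "compact (K n)" for n
      unfolding K_def using cl by (intro compact_Int_closed compact_strip_rect closed_INT) auto
    show "K n \<noteq> {}" for n
    proof -
      obtain z where z: "\<forall>j\<le>n. (f ^^ j) z \<in> R (s j) \<and> \<bar>Re ((f ^^ j) z) - (F ^^ j) \<eta>\<bar> \<le> C1"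
        using near_finite[OF assms] by blast
      then have "z \<in> K n" using z[rule_format, of 0] R_subset_cR by (fastforce simp: K_def)
      then show ?thesis by blast
    qed
    show "m \<le> n \<Longrightarrow> K n \<subseteq> K m" for m n
      by (auto simp: K_def)
  qed
  then obtain z where "\<And>n. z \<in> K n" by auto
  then show ?thesis by (auto simp: near_def K_def intro!: exI[of _ z])
qed

lemma near_itin: "nonzero_often s \<Longrightarrow> near s \<eta> z \<Longrightarrow> z \<in> itin s"
  by (simp add: near_def itin_iff_cR)

text \<open>The candidate is the real part at time n, pulled back n times by the inverse
  \<open>ln (1 + y)\<close> of \<open>F\<close>; \<open>push_step\<close> controls each
  pull-back.\<close>

lemma potential_finite:
  assumes "linearly_bounded a s" "\<And>j. (f ^^ j) z \<in> closed_R (s j)" "\<And>j. Re ((f ^^ j) z) \<ge> M + a + j"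
  shows "\<exists>y. \<forall>j\<le>n. \<bar>Re ((f ^^ j) z) - (F ^^ j) y\<bar> \<le> C1"
  using assms
proof (induction n arbitrary: s a z)
  case 0
  show ?case using C1_ge by (intro exI[of _ "Re z"]) simp
next
  case (Suc n)
  have a: "a \<ge> 0" using Suc.prems by (simp add: linearly_bounded_def)
  obtain y where y: "\<forall>j\<le>n. \<bar>Re ((f ^^ j) (f z)) - (F ^^ j) y\<bar> \<le> C1"
    using Suc.IH[of "a + 1" "shift_seq 1 s" "f z"] S_class_shift[OF Suc.prems(1), of 1]
      Suc.prems(2)[of "Suc _"] Suc.prems(3)[of "Suc _"]
    by (auto simp: shift_seq_def funpow_swap1 add_ac)
  have z0: "Re z \<ge> M + a" using Suc.prems(3)[of 0] by simp
  have "\<bar>y - Re (f z)\<bar> \<le> C1" using y[rule_format, of 0] by simp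
  moreover have "Re (f z) \<ge> 0" using Suc.prems(3)[of 1] M_ge3 a by simp
  moreover have "\<bar>Im (f z)\<bar> \<le> (2 * a + 3) * pi"
    using S_class_Im[OF Suc.prems(1), of "f z"] Suc.prems(2)[of 1] by simp
  ultimately have st: "\<bar>ln (1 + y) - Re z\<bar> \<le> C1" "1 + y > 0"
    using push_step[OF a z0] by blast+
  show ?case
  proof (intro exI[of _ "ln (1 + y)"] allI impI)
    fix j assume j: "j \<le> Suc n"
    show "\<bar>Re ((f ^^ j) z) - (F ^^ j) (ln (1 + y))\<bar> \<le> C1"
    proof (cases j)
      case 0
      then show ?thesis using st by simp
    next
      case (Suc i)
      then show ?thesis using y[rule_format, of i] j st(2)
        by (simp add: F_funpow_Suc funpow_f_Suc F_def del: funpow.simps)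
    qed
  qed
qed

lemma potential_exists:
  assumes "linearly_bounded a s" "\<And>j. (f ^^ j) z \<in> closed_R (s j)" "\<And>j. Re ((f ^^ j) z) \<ge> M + a + j"
  shows "\<exists>\<eta>. near s \<eta> z"
proof -
  define K where "K n = {Re z - C1..Re z + C1} \<inter> (\<Inter>j\<in>{..n}. {y. \<bar>Re ((f ^^ j) z) - (F ^^ j) y\<bar> \<le> C1})" for n
  have cl: "closed {y. \<bar>Re ((f ^^ j) z) - (F ^^ j) y\<bar> \<le> C1}" for j
    by (intro closed_Collect_le continuous_intros continuous_F_funpow)
  have "(\<Inter>n. K n) \<noteq> {}"
  proof (rule compact_nest)
    show "compact (K n)" for n
      unfolding K_def using cl by (intro compact_Int_closed closed_INT) auto
    show "K n \<noteq> {}" for n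
    proof -
      obtain y where y: "\<forall>j\<le>n. \<bar>Re ((f ^^ j) z) - (F ^^ j) y\<bar> \<le> C1"
        using potential_finite[OF assms] by blast
      then have "y \<in> K n" using y[rule_format, of 0] by (auto simp: K_def)
      then show ?thesis by blast
    qed
    show "m \<le> n \<Longrightarrow> K n \<subseteq> K m" for m n
      by (auto simp: K_def)
  qed
  then obtain y where "\<And>n. y \<in> K n" by auto
  then show ?thesis using assms(2) by (auto simp: near_def K_def intro!: exI[of _ y])
qed

section \<open>Expansion far to the right and uniqueness of orbits at bounded distance\<close>

lemma Lb_contr:
  assumes "Re a \<ge> 2" "Re b \<ge> 2"
  shows "norm (branch j a - branch j b) \<le> norm (a - b) / 2"
proof -
  have nz: "a \<noteq> 0" "b \<noteq> 0" using assms by auto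
  have "norm (Ln a - Ln b) \<le> 1/2 * norm (a - b)"
  proof (rule field_differentiable_bound[of "{z. Re z \<ge> 2}" Ln inverse])
    show "convex {z. Re z \<ge> 2}" by (rule convex_halfspace_Re_ge)
    show "(Ln has_field_derivative inverse z) (at z within {z. 2 \<le> Re z})" if "z \<in> {z. 2 \<le> Re z}" for z
      using that by (intro has_field_derivative_Ln[THEN has_field_derivative_at_within])
        (auto simp: complex_nonpos_Reals_iff)
    show "norm (inverse z) \<le> 1/2" if "z \<in> {z. 2 \<le> Re z}" for z
    proof -
      have "norm z \<ge> 2" using that complex_Re_le_cmod[of z] by simp
      then show ?thesis using le_imp_inverse_le[of 2 "norm z"] by (simp add: norm_inverse)
    qed
  qed (use assms in auto)
  moreover have "branch j a - branch j b = Ln a - Ln b"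
    using nz by (simp add: branch_def Ln_divide_of_real)
  ultimately show ?thesis by simp
qed

lemma f_expands:
  assumes "z \<in> R j" "w \<in> R j" "Re (f z) \<ge> 2" "Re (f w) \<ge> 2"
  shows "norm (z - w) \<le> norm (f z - f w) / 2"
  using Lb_contr[OF assms(3,4), of j] assms(1,2) by (simp add: Lb_f)

lemma funpow_expands:
  assumes "z \<in> itin s" "w \<in> itin s"
    "\<And>j. 1 \<le> j \<Longrightarrow> j \<le> n \<Longrightarrow> Re ((f ^^ j) z) \<ge> 2"
    "\<And>j. 1 \<le> j \<Longrightarrow> j \<le> n \<Longrightarrow> Re ((f ^^ j) w) \<ge> 2"
  shows "norm (z - w) \<le> norm ((f ^^ n) z - (f ^^ n) w) / 2 ^ n"
  using assms(3,4)
proof (induction n)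
  case (Suc n)
  have "norm ((f ^^ n) z - (f ^^ n) w) \<le> norm (f ((f ^^ n) z) - f ((f ^^ n) w)) / 2"
    using Suc.prems(1)[of "Suc n"] Suc.prems(2)[of "Suc n"] itin_R[OF assms(1)] itin_R[OF assms(2)]
    by (intro f_expands) auto
  moreover have "norm (z - w) \<le> norm ((f ^^ n) z - (f ^^ n) w) / 2 ^ n"
    using Suc by auto
  ultimately show ?case
    using divide_right_mono[of _ _ "2 ^ n"] by (fastforce simp: field_simps)
qed simp

lemma norm_diff_itin:
  assumes "z \<in> itin s" "w \<in> itin s"
  shows "norm ((f ^^ n) z - (f ^^ n) w) \<le> \<bar>Re ((f ^^ n) z) - Re ((f ^^ n) w)\<bar> + 2 * pi"
  using cmod_le[of "(f ^^ n) z - (f ^^ n) w"] cR_diff_Im[OF itin_cR[OF assms(1)] itin_cR[OF assms(2)], of n]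
  by simp

text \<open>Far to the right each step at least doubles the distance, while the common strip and the
  bound \<open>B\<close> keep it at most B + 2 \<pi> at all times. So the orbits agree at a late
  time, and injectivity carries this back to time 0.\<close>

lemma bounded_diff_eq:
  assumes "z \<in> itin s" "w \<in> itin s"
    and "\<forall>\<^sub>F j in sequentially. Re ((f ^^ j) z) \<ge> 2" "\<forall>\<^sub>F j in sequentially. Re ((f ^^ j) w) \<ge> 2"
    and B: "\<And>j. \<bar>Re ((f ^^ j) z) - Re ((f ^^ j) w)\<bar> \<le> B"
  shows "z = w"
proof -
  have "\<forall>\<^sub>F j in sequentially. Re ((f ^^ j) z) \<ge> 2 \<and> Re ((f ^^ j) w) \<ge> 2"
    using assms(3,4) by eventually_elim auto
  then obtain J where J: "\<And>j. j \<ge> J \<Longrightarrow> Re ((f ^^ j) z) \<ge> 2 \<and> Re ((f ^^ j) w) \<ge> 2"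
    by (auto simp: eventually_sequentially)
  define z' w' where "z' = (f ^^ J) z" and "w' = (f ^^ J) w"
  have it: "z' \<in> itin (shift_seq J s)" "w' \<in> itin (shift_seq J s)"
    using assms(1,2) itin_funpow by (auto simp: z'_def w'_def)
  have "norm (z' - w') \<le> (B + 2 * pi) / 2 ^ n" for n
  proof -
    have "norm (z' - w') \<le> norm ((f ^^ n) z' - (f ^^ n) w') / 2 ^ n"
      by (rule funpow_expands[OF it]) (use J in \<open>auto simp: z'_def w'_def simp flip: funpow_f_add\<close>)
    also have "\<dots> \<le> (B + 2 * pi) / 2 ^ n"
      using norm_diff_itin[OF assms(1,2), of "J + n"] B[of "J + n"]
      by (intro divide_right_mono) (auto simp: z'_def w'_def funpow_f_add)
    finally show ?thesis .
  qed
  moreover have "(\<lambda>n. (B + 2 * pi) / 2 ^ n) \<longlonglongrightarrow> 0"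
    by real_asymp
  ultimately have "norm (z' - w') \<le> 0"
    by (intro LIMSEQ_le_const) auto
  then show ?thesis using itin_inj[OF assms(1,2)] by (simp add: z'_def w'_def)
qed

end

section \<open>The hair\<close>

lemma F_ge_quadratic: "t \<ge> 0 \<Longrightarrow> F t \<ge> t + t\<^sup>2 / 2"
  using exp_lower_Taylor_quadratic[of t] by (simp add: F_def)

lemma F_funpow_ge_self: "t \<le> (F ^^ n) t"
proof (induction n)
  case (Suc n)
  have "x \<le> F x" for x using exp_ge_add_one_self[of x] unfolding F_def by linarith
  from order_trans[OF Suc this] show ?case by simp
qed simp

text \<open>Each step gains at least t^2 / 2, because the orbit never falls below its start. Hence
  even a small positive potential tends to infinity.\<close>

lemma F_funpow_ge_linear: "t > 0 \<Longrightarrow> (F ^^ n) t \<ge> t + n * (t\<^sup>2 / 2)"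
proof (induction n)
  case (Suc n)
  define u where "u = (F ^^ n) t"
  have "u \<ge> t" unfolding u_def by (rule F_funpow_ge_self)
  then have "t\<^sup>2 \<le> u\<^sup>2" using Suc.prems by (simp add: power_mono)
  then have "F u \<ge> u + t\<^sup>2 / 2" using F_ge_quadratic[of u] \<open>u \<ge> t\<close> Suc.prems by linarith
  moreover have "t + real n * (t\<^sup>2 / 2) \<le> u" using Suc by (simp add: u_def)
  ultimately show ?case by (simp add: u_def algebra_simps add_divide_distrib)
qed simp

lemma F_funpow_at_top:
  assumes "t > 0" shows "filterlim (\<lambda>n. (F ^^ n) t) at_top sequentially"
proof (rule filterlim_at_top_mono)
  show "filterlim (\<lambda>n. t + real n * (t\<^sup>2 / 2)) at_top sequentially"
    using assms by real_asymp
  show "\<forall>\<^sub>F n in sequentially. t + real n * (t\<^sup>2 / 2) \<le> (F ^^ n) t"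
    using F_funpow_ge_linear[OF assms] by simp
qed

lemma F_funpow_mono: "a \<le> b \<Longrightarrow> (F ^^ n) a \<le> (F ^^ n) b"
  by (induction n) (simp_all add: F_def)

text \<open>For current values u < v one has F v - F u = exp u (exp (v - u) - 1) >= (1 + a) (v - u).
  This divergence makes the potential of a point unique.\<close>

lemma F_funpow_diff: "0 < a \<Longrightarrow> a < b \<Longrightarrow> (F ^^ n) b - (F ^^ n) a \<ge> (1 + a) ^ n * (b - a)"
proof (induction n)
  case (Suc n)
  define u v where "u = (F ^^ n) a" and "v = (F ^^ n) b"
  have "u \<ge> a" unfolding u_def by (rule F_funpow_ge_self)
  have d: "(1 + a) ^ n * (b - a) \<le> v - u" using Suc by (simp add: u_def v_def)
  have d0: "0 \<le> (1 + a) ^ n * (b - a)" using Suc.prems by simp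
  have "(1 + a) ^ Suc n * (b - a) \<le> (1 + a) * (v - u)"
    using mult_left_mono[OF d, of "1 + a"] Suc.prems by (simp add: mult_ac)
  also have "\<dots> \<le> exp u * (v - u)"
  proof (rule mult_right_mono)
    show "1 + a \<le> exp u" using exp_ge_add_one_self[of u] \<open>u \<ge> a\<close> by linarith
  qed (use d d0 in linarith)
  also have "\<dots> \<le> exp u * (exp (v - u) - 1)"
  proof (rule mult_left_mono)
    show "v - u \<le> exp (v - u) - 1" using exp_ge_add_one_self[of "v - u"] by linarith
  qed simp
  also have "\<dots> = F v - F u" by (simp add: F_def right_diff_distrib flip: exp_add)
  finally show ?case by (simp add: u_def v_def)
qed simp

lemma F_funpow_surj: "t > 0 \<Longrightarrow> \<exists>x>0. (F ^^ n) x = t"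
proof (induction n arbitrary: t)
  case (Suc n)
  have "ln (1 + t) > 0" "F (ln (1 + t)) = t" using Suc.prems by (simp_all add: F_def)
  then show ?case using Suc.IH[of "ln (1 + t)"] by auto
qed auto

text \<open>The last clause lets the estimates restart with \<open>a = 0\<close> at arbitrarily late
  times, when a small potential has grown past \<open>M\<close>.\<close>

definition good :: "(nat \<Rightarrow> int) \<Rightarrow> bool" where
  "good s \<longleftrightarrow> nonzero_often s \<and> linearly_bounded 0 s \<and> (\<forall>m. \<exists>k\<ge>m. linearly_bounded 0 (shift_seq k s))"

lemma good_rec_nz: "good s \<Longrightarrow> nonzero_often s" by (simp add: good_def)

section \<open>The correspondence between potentials and escaping points\<close>

context expo begin

text \<open>Unlike in \<open>near\<close>, the bound is arbitrary, so that small potentials are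
  covered, whose early orbit need not obey the estimate with \<open>C1\<close>.\<close>

definition has_potential :: "(nat \<Rightarrow> int) \<Rightarrow> real \<Rightarrow> complex \<Rightarrow> bool" where
  "has_potential s \<eta> z \<longleftrightarrow> z \<in> itin s \<and> (\<exists>B. \<forall>j. \<bar>Re ((f ^^ j) z) - (F ^^ j) \<eta>\<bar> \<le> B)"

lemma near_imp_pot:
  assumes "z \<in> itin s" "near (shift_seq k s) ((F ^^ k) \<eta>) ((f ^^ k) z)"
  shows "has_potential s \<eta> z"
proof -
  define g where "g j = \<bar>Re ((f ^^ j) z) - (F ^^ j) \<eta>\<bar>" for j
  \<comment> \<open>The finitely many times before \<open>k\<close> enter only through the sum of
    their errors.\<close>
  have "g j \<le> C1 + (\<Sum>i<k. g i)" for j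
  proof (cases "j < k")
    case True
    then have "g j \<le> (\<Sum>i<k. g i)" by (intro member_le_sum) (auto simp: g_def)
    then show ?thesis using C1_ge by simp
  next
    case False
    define i where "i = j - k"
    have "j = k + i" using False by (simp add: i_def)
    moreover have "(F ^^ (k + i)) \<eta> = (F ^^ i) ((F ^^ k) \<eta>)"
      by (subst add.commute) (simp add: funpow_add)
    ultimately have "g j \<le> C1" using assms(2) by (simp add: near_def g_def funpow_f_add)
    moreover have "(\<Sum>i<k. g i) \<ge> 0" by (intro sum_nonneg) (auto simp: g_def)
    ultimately show ?thesis by simp
  qed
  then show ?thesis using assms(1) by (auto simp: has_potential_def g_def)
qed

lemma pot_at_top:
  assumes "\<eta> > 0" "has_potential s \<eta> z"
  shows "filterlim (\<lambda>j. Re ((f ^^ j) z)) at_top sequentially"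
proof -
  obtain B where B: "\<And>j. \<bar>Re ((f ^^ j) z) - (F ^^ j) \<eta>\<bar> \<le> B" using assms(2) by (auto simp: has_potential_def)
  have "filterlim (\<lambda>j. - B + (F ^^ j) \<eta>) at_top sequentially"
    by (rule filterlim_tendsto_add_at_top[OF tendsto_const F_funpow_at_top[OF assms(1)]])
  then show ?thesis
  proof (rule filterlim_at_top_mono)
    have "- B + (F ^^ j) \<eta> \<le> Re ((f ^^ j) z)" for j using B[of j] by (simp add: abs_le_iff)
    then show "\<forall>\<^sub>F j in sequentially. - B + (F ^^ j) \<eta> \<le> Re ((f ^^ j) z)" by simp
  qed
qed

lemma pot_unique:
  assumes "\<eta> > 0" "has_potential s \<eta> z" "has_potential s \<eta> w"
  shows "z = w"
proof -
  obtain B where B: "\<And>j. \<bar>Re ((f ^^ j) z) - (F ^^ j) \<eta>\<bar> \<le> B" using assms(2) by (auto simp: has_potential_def)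
  obtain B' where B': "\<And>j. \<bar>Re ((f ^^ j) w) - (F ^^ j) \<eta>\<bar> \<le> B'" using assms(3) by (auto simp: has_potential_def)
  show ?thesis
  proof (rule bounded_diff_eq[of z s w "B + B'"])
    show "\<bar>Re ((f ^^ j) z) - Re ((f ^^ j) w)\<bar> \<le> B + B'" for j
      using B[of j] B'[of j] by linarith
  qed (use assms pot_at_top[OF assms(1)] in \<open>auto simp: has_potential_def filterlim_at_top\<close>)
qed

lemma pot_inj:
  assumes "0 < \<eta>" "\<eta> < \<eta>'" "has_potential s \<eta> z" "has_potential s \<eta>' z"
  shows False
proof -
  obtain B where B: "\<And>j. \<bar>Re ((f ^^ j) z) - (F ^^ j) \<eta>\<bar> \<le> B" using assms(3) by (auto simp: has_potential_def)
  obtain B' where B': "\<And>j. \<bar>Re ((f ^^ j) z) - (F ^^ j) \<eta>'\<bar> \<le> B'" using assms(4) by (auto simp: has_potential_def)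
  have "(1 + \<eta>) ^ j * (\<eta>' - \<eta>) \<le> B + B'" for j
    using F_funpow_diff[OF assms(1,2), of j] B[of j] B'[of j] by linarith
  moreover have "filterlim (\<lambda>j. (1 + \<eta>) ^ j * (\<eta>' - \<eta>)) at_top sequentially"
    using assms(1,2) by real_asymp
  then obtain j where "(1 + \<eta>) ^ j * (\<eta>' - \<eta>) > B + B'"
    by (metis (mono_tags, lifting) filterlim_at_top_dense eventually_happens sequentially_bot)
  ultimately show False by (meson not_less)
qed

lemma good_S_class:
  assumes "good s" "\<eta> > 0"
  obtains k where "k \<ge> m" "linearly_bounded 0 (shift_seq k s)" "(F ^^ k) \<eta> \<ge> M"
proof -
  obtain K where "\<And>k. k \<ge> K \<Longrightarrow> (F ^^ k) \<eta> \<ge> M"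
    using F_funpow_at_top[OF assms(2)] by (auto simp: filterlim_at_top eventually_sequentially)
  then show thesis
    using that assms(1) unfolding good_def by (metis max.bounded_iff)
qed

lemma pot_exists_near:
  assumes "good s" "linearly_bounded 0 (shift_seq k s)" "(F ^^ k) \<eta> \<ge> M"
  obtains z where "has_potential s \<eta> z" "near (shift_seq k s) ((F ^^ k) \<eta>) ((f ^^ k) z)"
proof -
  obtain w where w: "near (shift_seq k s) ((F ^^ k) \<eta>) w"
    using near_exists[OF assms(2)] assms(3) by auto
  have rn: "nonzero_often s" using assms(1) good_rec_nz by blast
  then have "w \<in> itin (shift_seq k s)" using w near_itin rec_nz_shift by blast
  then obtain z where "z \<in> itin s" "(f ^^ k) z = w" using itin_surj rn by blast
  then show thesis using that w near_imp_pot by metis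
qed

lemma pot_exists: "good s \<Longrightarrow> \<eta> > 0 \<Longrightarrow> \<exists>z. has_potential s \<eta> z"
  by (metis good_S_class pot_exists_near)

lemma pot_Esc:
  assumes "\<eta> > 0" "has_potential s \<eta> z" shows "z \<in> Esc s"
proof -
  have "filterlim (\<lambda>j. norm ((f ^^ j) z)) at_top sequentially"
    by (rule filterlim_at_top_mono[OF pot_at_top[OF assms]]) (simp add: complex_Re_le_cmod)
  then show ?thesis
    using assms(2) by (simp add: escaping_set_def has_potential_def filterlim_norm_at_top_imp_at_infinity)
qed

text \<open>The modulus at time j + 1 is \<open>lam\<close> times the exponential of the real part
  at time j, so divergence of the modulus forces the real part to +\<infinity>.\<close>

lemma Esc_Re_at_top:
  assumes "z \<in> Esc s" shows "filterlim (\<lambda>j. Re ((f ^^ j) z)) at_top sequentially"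
proof -
  have "filterlim (\<lambda>j. norm ((f ^^ j) z)) at_top sequentially"
    using assms filterlim_at_infinity_imp_norm_at_top by (auto simp: escaping_set_def)
  then have "filterlim (\<lambda>j. norm ((f ^^ Suc j) z)) at_top sequentially"
    by (rule filterlim_sequentially_Suc[THEN iffD2])
  then have "filterlim (\<lambda>j. - ln lam + ln (norm ((f ^^ Suc j) z))) at_top sequentially"
    by (intro filterlim_tendsto_add_at_top[OF tendsto_const] filterlim_compose[OF ln_at_top])
  then show ?thesis by (simp add: norm_f ln_mult)
qed

lemma Esc_itin: "z \<in> Esc s \<Longrightarrow> z \<in> itin s"
  by (simp add: escaping_set_def)

text \<open>The modulus of the next point is at least lam exp (M + j), far above the height (2 j +
  3) \<pi> allowed by its strip; its real part, being positive, must carry the rest. This upgrades a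
  constant lower bound to the linear one required by \<open>potential_exists\<close>.\<close>

lemma Re_growth:
  assumes "linearly_bounded 0 s" "w \<in> itin s" "\<And>j. Re ((f ^^ j) w) \<ge> M"
  shows "Re ((f ^^ j) w) \<ge> M + j"
proof (induction j)
  case (Suc j)
  define u where "u = (f ^^ j) w"
  have "f u \<in> closed_R (s (Suc j))" using itin_cR[OF assms(2), of "Suc j"] by (simp add: u_def)
  moreover have "\<bar>real_of_int (s (Suc j))\<bar> \<le> real (Suc j)" using assms(1) unfolding linearly_bounded_def by (metis add_0)
  then have "(2 * \<bar>real_of_int (s (Suc j))\<bar> + 1) * pi \<le> (2 * real j + 3) * pi" by simp
  ultimately have im: "\<bar>Im (f u)\<bar> \<le> (2 * real j + 3) * pi"
    using cR_abs_Im(1)[of "f u" "s (Suc j)"] by linarith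
  have "4 * ((2 * real j + 3) * pi + C1 + 1 + M + real j) \<le> lam * exp (M + real j)"
    by (rule order_trans[OF M_exp mult_right_mono]) simp_all
  also have "\<dots> \<le> norm (f u)" using Suc by (simp add: norm_f u_def)
  finally have n: "4 * ((2 * real j + 3) * pi + C1 + 1 + M + real j) \<le> norm (f u)" .
  have re: "Re (f u) \<ge> M" using assms(3)[of "Suc j"] by (simp add: u_def)
  then have "norm (f u) \<le> Re (f u) + \<bar>Im (f u)\<bar>" using cmod_le[of "f u"] M_ge3 by simp
  moreover have "(2 * real j + 3) * pi \<ge> 0" by simp
  ultimately have "Re (f u) \<ge> M + (real j + 1)" using n im C1_ge M_ge3
    by (simp only: distrib_left)
  then show ?case by (simp add: u_def)
qed (use assms(3)[of 0] in simp)

text \<open>A late iterate is far enough to the right to have a potential with error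
  \<open>C1\<close>. This potential is positive, hence the \<open>k\<close>-th image under
  \<open>F\<close> of some positive \<open>\<eta>\<close>.\<close>

lemma Esc_pot:
  assumes "good s" "z \<in> Esc s"
  shows "\<exists>\<eta>>0. has_potential s \<eta> z"
proof -
  obtain K where K: "\<And>j. j \<ge> K \<Longrightarrow> Re ((f ^^ j) z) \<ge> M"
    using Esc_Re_at_top[OF assms(2)] by (auto simp: filterlim_at_top eventually_sequentially)
  obtain k where k: "k \<ge> K" "linearly_bounded 0 (shift_seq k s)" using assms(1) good_def by blast
  define w where "w = (f ^^ k) z"
  have z: "z \<in> itin s" using assms(2) by (rule Esc_itin)
  then have w: "w \<in> itin (shift_seq k s)" by (simp add: w_def itin_funpow)
  have "Re ((f ^^ j) w) \<ge> M" for j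
    using K[of "k + j"] k(1) by (simp add: w_def funpow_f_add)
  then have "Re ((f ^^ j) w) \<ge> M + 0 + j" for j using Re_growth[OF k(2) w] by simp
  then obtain y where y: "near (shift_seq k s) y w"
    using potential_exists[OF k(2) itin_cR[OF w]] by blast
  have "\<bar>Re w - y\<bar> \<le> C1" using y unfolding near_def by (metis funpow_0)
  moreover have "Re w \<ge> M" using K[OF k(1)] by (simp add: w_def)
  ultimately have "y > 0" using M_ge by linarith
  then obtain \<eta> where "\<eta> > 0" "(F ^^ k) \<eta> = y" using F_funpow_surj by blast
  then show ?thesis using near_imp_pot[OF z, of k \<eta>] y by (auto simp: w_def)
qed

section \<open>Continuity of the pull-back and of the hair\<close>

lemma isCont_Lb: "Im w \<noteq> 0 \<Longrightarrow> isCont (branch j) w"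
  unfolding branch_def
  by (intro continuous_intros) (auto simp: complex_nonpos_Reals_iff)

text \<open>Each inverse step is a branch of the logarithm, continuous off the real axis, and points
  with the shifted itinerary are never real.\<close>

lemma itin_inverse_continuous:
  assumes "nonzero_often s" "z \<in> itin s" "\<epsilon> > 0"
  shows "\<exists>\<delta>>0. \<forall>w\<in>itin s. dist ((f ^^ k) w) ((f ^^ k) z) < \<delta> \<longrightarrow> dist w z < \<epsilon>"
  using assms
proof (induction k arbitrary: s z \<epsilon>)
  case (Suc k)
  have fz: "f z \<in> itin (shift_seq 1 s)" "z \<in> R (s 0)" using Suc.prems(2) itin_Suc by blast+
  have rn: "nonzero_often (shift_seq 1 s)" using Suc.prems(1) rec_nz_shift by blast
  have "isCont (branch (s 0)) (f z)" using itin_nonreal[OF rn fz(1)] by (rule isCont_Lb)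
  then obtain \<epsilon>' where e: "\<epsilon>' > 0" "\<And>w. dist w (f z) < \<epsilon>' \<Longrightarrow> dist (branch (s 0) w) (branch (s 0) (f z)) < \<epsilon>"
    unfolding continuous_at_eps_delta using Suc.prems(3) by blast
  obtain \<delta> where d: "\<delta> > 0" "\<forall>w\<in>itin (shift_seq 1 s). dist ((f ^^ k) w) ((f ^^ k) (f z)) < \<delta> \<longrightarrow> dist w (f z) < \<epsilon>'"
    using Suc.IH[OF rn fz(1) e(1)] by blast
  show ?case
  proof (intro exI[of _ \<delta>] conjI ballI impI d(1))
    fix w assume w: "w \<in> itin s" "dist ((f ^^ Suc k) w) ((f ^^ Suc k) z) < \<delta>"
    have fw: "f w \<in> itin (shift_seq 1 s)" "w \<in> R (s 0)" using w(1) itin_Suc by blast+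
    then have "dist (f w) (f z) < \<epsilon>'" using d(2) w(2) unfolding funpow_f_Suc by blast
    then show "dist w z < \<epsilon>" using e(2) Lb_f fw(2) fz(2) by metis
  qed
qed auto

definition hair :: "(nat \<Rightarrow> int) \<Rightarrow> real \<Rightarrow> complex" where
  "hair s \<eta> = (THE z. has_potential s \<eta> z)"

lemma hair_eq: "\<eta> > 0 \<Longrightarrow> has_potential s \<eta> z \<Longrightarrow> hair s \<eta> = z"
  unfolding hair_def using pot_unique by blast

lemma hair_pot: "good s \<Longrightarrow> \<eta> > 0 \<Longrightarrow> has_potential s \<eta> (hair s \<eta>)"
  using pot_exists hair_eq by metis

lemma hair_near:
  assumes "good s" "\<eta> > 0" "linearly_bounded 0 (shift_seq k s)" "(F ^^ k) \<eta> \<ge> M"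
  shows "near (shift_seq k s) ((F ^^ k) \<eta>) ((f ^^ k) (hair s \<eta>))"
  using pot_exists_near[OF assms(1,3,4)] hair_eq[OF assms(2)] by metis

text \<open>The integer \<open>n\<close> is free: a large \<open>n\<close> makes the constants
  negligible, after which closeness of the potentials controls the remaining term.\<close>

lemma near_dist:
  assumes "nonzero_often s" "near s \<eta> z" "near s \<eta>' w" "\<eta> \<ge> M" "\<eta>' \<ge> M"
  shows "norm (z - w) \<le> (\<bar>(F ^^ n) \<eta> - (F ^^ n) \<eta>'\<bar> + 2 * C1 + 2 * pi) / 2 ^ n"
proof -
  have it: "z \<in> itin s" "w \<in> itin s" using near_itin assms by blast+
  have ge: "Re ((f ^^ j) y) \<ge> 2" if "near s \<xi> y" "\<xi> \<ge> M" for j y \<xi>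
  proof -
    have "(F ^^ j) \<xi> \<ge> M" using F_funpow_ge[of \<xi> j] that(2) M_ge3 by linarith
    moreover have "\<bar>Re ((f ^^ j) y) - (F ^^ j) \<xi>\<bar> \<le> C1" using that(1) by (simp add: near_def)
    ultimately show ?thesis using M_ge by linarith
  qed
  have "norm (z - w) \<le> norm ((f ^^ n) z - (f ^^ n) w) / 2 ^ n"
    using ge assms by (intro funpow_expands[OF it]) auto
  also have "norm ((f ^^ n) z - (f ^^ n) w) \<le> \<bar>(F ^^ n) \<eta> - (F ^^ n) \<eta>'\<bar> + 2 * C1 + 2 * pi"
  proof -
    have "\<bar>Re ((f ^^ n) z) - (F ^^ n) \<eta>\<bar> \<le> C1" "\<bar>Re ((f ^^ n) w) - (F ^^ n) \<eta>'\<bar> \<le> C1"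
      using assms(2,3) by (auto simp: near_def)
    then show ?thesis using norm_diff_itin[OF it, of n] by linarith
  qed
  finally show ?thesis by (simp add: divide_right_mono)
qed

lemma continuous_hair:
  assumes "good s" shows "continuous_on {0<..} (hair s)"
proof (subst continuous_on_eq_continuous_at)
  show "\<forall>x\<in>{0<..}. isCont (hair s) x"
  proof
    fix x :: real assume "x \<in> {0<..}"
    then have x: "x > 0" by simp
    have rn: "nonzero_often s" using assms good_rec_nz by blast
    \<comment> \<open>Potentials above x / 2 form a neighbourhood of x, and all of them have passed
      \<open>M\<close> at the same time \<open>k\<close>.\<close>
    obtain k where k: "linearly_bounded 0 (shift_seq k s)" "(F ^^ k) (x / 2) \<ge> M"
      using good_S_class[OF assms, of "x / 2" 0] x by auto
    have ge: "(F ^^ k) y \<ge> M" if "y > x / 2" for y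
      using F_funpow_mono[of "x / 2" y k] k(2) that by linarith
    have near: "near (shift_seq k s) ((F ^^ k) y) ((f ^^ k) (hair s y))" if "y > x / 2" for y
      using hair_near[OF assms _ k(1) ge] that x by simp
    show "isCont (hair s) x"
      unfolding continuous_at_eps_delta
    proof (intro allI impI)
      fix e :: real assume "e > 0"
      have hx: "hair s x \<in> itin s" using hair_pot[OF assms x] by (simp add: has_potential_def)
      obtain d where d: "d > 0" "\<And>w. w \<in> itin s \<Longrightarrow> dist ((f ^^ k) w) ((f ^^ k) (hair s x)) < d \<Longrightarrow> dist w (hair s x) < e"
        using itin_inverse_continuous[OF rn hx \<open>e > 0\<close>] by blast
      \<comment> \<open>First \<open>n\<close> is fixed; the radius \<open>r\<close> is then chosen
        by continuity of the single map \<open>F^(n + k)\<close>.\<close>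
      have "((\<lambda>n. (1 + 2 * C1 + 2 * pi) / 2 ^ n) \<longlongrightarrow> 0) sequentially" by real_asymp
      then obtain n where n: "(1 + 2 * C1 + 2 * pi) / 2 ^ n < d"
        using d(1) by (metis (mono_tags, lifting) order_tendstoD(2) eventually_happens sequentially_bot)
      have "isCont (\<lambda>y. (F ^^ n) ((F ^^ k) y)) x"
        using continuous_F_funpow[of UNIV "n + k"]
        by (simp add: funpow_add o_def continuous_on_eq_continuous_at)
      then obtain r where r: "r > 0" "\<And>y. dist y x < r \<Longrightarrow> dist ((F ^^ n) ((F ^^ k) y)) ((F ^^ n) ((F ^^ k) x)) < 1"
        unfolding continuous_at_eps_delta by (meson zero_less_one)
      show "\<exists>d>0. \<forall>x'. dist x' x < d \<longrightarrow> dist (hair s x') (hair s x) < e"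
      proof (intro exI[of _ "min r (x / 2)"] conjI allI impI)
        fix y assume y: "dist y x < min r (x / 2)"
        then have y2: "y > x / 2" unfolding dist_real_def min_less_iff_conj by arith
        have "dist ((f ^^ k) (hair s y)) ((f ^^ k) (hair s x)) \<le>
          (\<bar>(F ^^ n) ((F ^^ k) y) - (F ^^ n) ((F ^^ k) x)\<bar> + 2 * C1 + 2 * pi) / 2 ^ n"
          unfolding dist_norm
          by (rule near_dist[OF rec_nz_shift[OF rn] near near]) (use ge y2 x in auto)
        also have "\<dots> \<le> (1 + 2 * C1 + 2 * pi) / 2 ^ n"
          using r(2)[of y] y by (intro divide_right_mono) (auto simp: dist_real_def)
        finally have "dist ((f ^^ k) (hair s y)) ((f ^^ k) (hair s x)) < d" using n by simp
        then show "dist (hair s y) (hair s x) < e"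
          using d(2) hair_pot[OF assms, of y] y2 x by (simp add: has_potential_def)
      qed (use r x in auto)
    qed
  qed
qed auto

lemma inj_hair: "good s \<Longrightarrow> inj_on (hair s) {0<..}"
proof (rule inj_onI)
  fix x y assume "good s" "x \<in> {0<..}" "y \<in> {0<..}" "hair s x = hair s y"
  then show "x = y"
    using pot_inj[of x y s "hair s x"] pot_inj[of y x s "hair s x"] hair_pot[of s x] hair_pot[of s y]
    by (metis greaterThan_iff linorder_neqE_linordered_idom)
qed

lemma hair_image: "good s \<Longrightarrow> hair s ` {0<..} = Esc s"
proof (intro equalityI subsetI)
  fix z assume "good s" "z \<in> Esc s"
  then obtain \<eta> where "\<eta> > 0" "has_potential s \<eta> z" using Esc_pot by blast
  then show "z \<in> hair s ` {0<..}" using hair_eq by force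
qed (auto intro: pot_Esc hair_pot)

lemma hair_at_infinity:
  assumes "good s" shows "filterlim (hair s) at_infinity at_top"
proof -
  have "filterlim (\<lambda>\<eta>. norm (hair s \<eta>)) at_top at_top"
  proof (rule filterlim_at_top_mono)
    show "filterlim (\<lambda>\<eta>. - C1 + \<eta>) at_top at_top"
      by (rule filterlim_tendsto_add_at_top[OF tendsto_const filterlim_ident])
    show "\<forall>\<^sub>F \<eta> in at_top. - C1 + \<eta> \<le> norm (hair s \<eta>)"
      using eventually_ge_at_top[of M]
    proof eventually_elim
      case (elim \<eta>)
      have "near s \<eta> (hair s \<eta>)"
        using hair_near[OF assms, of \<eta> 0] elim M_ge3 assms by (simp add: good_def)
      then have "\<bar>Re (hair s \<eta>) - \<eta>\<bar> \<le> C1" unfolding near_def by (metis funpow_0)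
      then show ?case using complex_Re_le_cmod[of "hair s \<eta>"] by linarith
    qed
  qed
  then show ?thesis by (rule filterlim_norm_at_top_imp_at_infinity)
qed

lemma good_exponentially_bounded:
  assumes "linearly_bounded 0 s" shows "exponentially_bounded s"
proof -
  have F: "F = (\<lambda>t. exp t - 1)" by (auto simp: F_def)
  have "\<bar>real_of_int (s k)\<bar> < 2 * (F ^^ k) 1" for k
  proof -
    have "\<bar>real_of_int (s k)\<bar> \<le> real k" using assms unfolding linearly_bounded_def by (metis add_0)
    then show ?thesis using F_funpow_ge_linear[of 1 k] by simp
  qed
  then show ?thesis unfolding exponentially_bounded_def F by (meson zero_less_numeral zero_less_one)
qed

lemma is_hair_hair: "good s \<Longrightarrow> is_hair lam s (hair s)"
  unfolding is_hair_def
  using good_exponentially_bounded hair_at_infinity continuous_hair inj_hair hair_image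
  by (auto simp: good_def nonzero_often_def eventually_sequentially)

end

section \<open>Density of the hair\<close>

text \<open>On the disc of radius |x| about 1 the derivative is at most 1 / (1 - |x|) <= 1 + 2 |x|.
  With |x| <= 1 / (2 N), the factors of N such steps compound to at most (1 + 1/N)^N.\<close>

lemma norm_Ln_1_le:
  assumes "norm x \<le> 1/2" shows "norm (Ln (1 + x)) \<le> norm x * (1 + 2 * norm x)"
proof -
  define r where "r = norm x"
  have "norm (Ln (1 + x) - Ln 1) \<le> (1 + 2 * r) * norm ((1 + x) - 1)"
  proof (rule field_differentiable_bound[of "cball 1 r" Ln inverse])
    fix z :: complex assume z: "z \<in> cball 1 r"
    have n: "norm z \<ge> 1 - r" using z norm_triangle_ineq2[of 1 "1 - z"] by (simp add: dist_norm)
    have "Re z > 0" using z abs_Re_le_cmod[of "1 - z"] assms by (simp add: dist_norm r_def)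
    then show "(Ln has_field_derivative inverse z) (at z within cball 1 r)"
      by (intro has_field_derivative_Ln[THEN has_field_derivative_at_within])
        (auto simp: complex_nonpos_Reals_iff)
    have r: "0 \<le> r" "r \<le> 1/2" using assms by (auto simp: r_def)
    have "norm (inverse z) \<le> inverse (1 - r)"
      using n r by (simp add: norm_inverse le_imp_inverse_le)
    also have "1 \<le> (1 + 2 * r) * (1 - r)"
      using r mult_left_mono[of r "1/2" r] by (simp add: algebra_simps)
    then have "inverse (1 - r) \<le> 1 + 2 * r"
      using r by (simp add: field_simps)
    finally show "norm (inverse z) \<le> 1 + 2 * r" .
  qed (auto simp: r_def dist_norm)
  then show ?thesis by (simp add: r_def mult_ac)
qed

lemma norm_exp_m1_le:
  fixes x :: complex
  assumes "norm x \<le> 1" shows "norm (exp x - 1) \<le> norm x * (1 + 2 * norm x)"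
proof -
  define r where "r = norm x"
  have r: "0 \<le> r" "r \<le> 1" using assms by (auto simp: r_def)
  have e: "exp r \<le> 1 + 2 * r"
    using exp_bound[OF r] mult_left_mono[OF r(2), of r] r by (simp add: power2_eq_square)
  have "norm (exp x - exp 0) \<le> (1 + 2 * r) * norm (x - 0)"
  proof (rule field_differentiable_bound[of "cball 0 r" exp exp])
    fix z :: complex assume z: "z \<in> cball 0 r"
    have "norm (exp z) \<le> exp (norm z)" by (rule norm_exp)
    also have "\<dots> \<le> exp r" using z by simp
    finally show "norm (exp z) \<le> 1 + 2 * r" using e by linarith
    show "(exp has_field_derivative exp z) (at z within cball 0 r)"
      by (intro DERIV_exp[THEN has_field_derivative_at_within])
  qed (auto simp: r_def)
  then show ?thesis by (simp add: r_def mult_ac)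
qed

section \<open>The orbit of the singular value\<close>

context expo begin

definition zero_orbit :: "nat \<Rightarrow> real" where "zero_orbit n = ((\<lambda>x. lam * exp x) ^^ n) 0"

text \<open>The derivative at 0 of the \<open>n\<close>-th iterate of \<open>f\<close>: the
  derivative of \<open>f\<close> at a point of the orbit is the next point.\<close>

definition zero_orbit_prod :: "nat \<Rightarrow> real" where "zero_orbit_prod n = (\<Prod>l<n. zero_orbit (Suc l))"

lemma ro_0 [simp]: "zero_orbit 0 = 0" and ro_Suc: "zero_orbit (Suc n) = lam * exp (zero_orbit n)"
  by (simp_all add: zero_orbit_def)

lemma zero_orbit_prod_0 [simp]: "zero_orbit_prod 0 = 1" and zero_orbit_prod_Suc: "zero_orbit_prod (Suc n) = zero_orbit_prod n * zero_orbit (Suc n)"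
  by (simp_all add: zero_orbit_prod_def)

lemma ro_nonneg: "zero_orbit n \<ge> 0"
  by (cases n) (simp_all add: ro_Suc)

lemma ro_Suc_ge: "zero_orbit (Suc n) \<ge> 1/3"
proof -
  have "lam * 1 \<le> lam * exp (zero_orbit n)" using ro_nonneg by (intro mult_left_mono) auto
  then show ?thesis using lam_third unfolding ro_Suc by linarith
qed

lemma ro_Suc_pos [simp]: "zero_orbit (Suc n) > 0" by (simp add: ro_Suc)

lemma zero_orbit_prod_pos [simp]: "zero_orbit_prod n > 0" by (simp add: zero_orbit_prod_def prod_pos)

lemma zero_orbit_prod_nonneg [simp]: "zero_orbit_prod n \<ge> 0" and zero_orbit_prod_nonzero [simp]: "zero_orbit_prod n \<noteq> 0"
  using zero_orbit_prod_pos[of n] by linarith+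

text \<open>The hypothesis \<open>lam > 1 / exp 1\<close> makes d = 1 + ln lam positive, and lam exp
  x = exp (x + ln lam) >= x + d. So the orbit of 0 gains at least d at each step.\<close>

lemma ro_at_top: "filterlim zero_orbit at_top sequentially"
proof (rule filterlim_at_top_mono)
  have d: "1 + ln lam > 0"
  proof -
    have "ln lam > ln (1 / exp 1)" using lam_gt by (subst ln_less_cancel_iff) auto
    then show ?thesis by (simp add: ln_div)
  qed
  show "filterlim (\<lambda>n. real n * (1 + ln lam)) at_top sequentially"
    using d by real_asymp
  have "real n * (1 + ln lam) \<le> zero_orbit n" for n
  proof (induction n)
    case (Suc n)
    have "zero_orbit (Suc n) = exp (ln lam + zero_orbit n)" by (simp add: ro_Suc exp_add)
    moreover have "real (Suc n) * (1 + ln lam) = real n * (1 + ln lam) + 1 + ln lam"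
      by (simp add: algebra_simps)
    ultimately show ?case using Suc exp_ge_add_one_self[of "ln lam + zero_orbit n"] by linarith
  qed simp
  then show "\<forall>\<^sub>F n in sequentially. real n * (1 + ln lam) \<le> zero_orbit n" by simp
qed

text \<open>The base 4 is chosen to beat the factor 3 per step that is lost in
  \<open>Q_ge\<close>.\<close>

lemma ro_ge_geometric: "\<exists>c>0. \<forall>\<^sub>F n in sequentially. zero_orbit n \<ge> c * 4 ^ n"
proof -
  have "\<forall>\<^sub>F x in at_top. lam * exp x \<ge> 4 * x" by real_asymp
  then have "\<forall>\<^sub>F n in sequentially. lam * exp (zero_orbit n) \<ge> 4 * zero_orbit n"
    by (rule eventually_compose_filterlim[OF _ ro_at_top])
  then obtain n0 where n0: "\<And>n. n \<ge> n0 \<Longrightarrow> zero_orbit (Suc n) \<ge> 4 * zero_orbit n"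
    by (auto simp: eventually_sequentially ro_Suc)
  define c where "c = zero_orbit (Suc n0) / 4 ^ Suc n0"
  have "c > 0" by (simp add: c_def)
  moreover have "zero_orbit n \<ge> c * 4 ^ n" if "n \<ge> Suc n0" for n
    using that
  proof (induction n rule: dec_induct)
    case (step n)
    then show ?case using n0[of n] by simp
  qed (simp add: c_def)
  ultimately show ?thesis unfolding eventually_sequentially by blast
qed

lemma Q_ge: "zero_orbit_prod (i + k) \<ge> zero_orbit_prod i * (1/3) ^ k"
proof (induction k)
  case (Suc k)
  have "zero_orbit_prod i * (1/3) ^ k * (1/3) \<le> zero_orbit_prod (i + k) * zero_orbit (Suc (i + k))"
    using Suc ro_Suc_ge[of "i + k"] by (intro mult_mono) auto
  then show ?case by (simp add: zero_orbit_prod_Suc mult_ac)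
qed simp

text \<open>The ratio of the upper bound in \<open>close_point\<close> to the lower bound in
  \<open>itin_norm_ge\<close>: 3 bounds the distortion over a block of zeros, and C1 + 3 \<pi>, per
  unit of |s N|, the distance from \<open>zero_orbit N\<close> at its end.\<close>

definition C2 :: real where "C2 = 3 * (C1 + 3 * pi)"

lemma C1_pi_ge: "C1 + 3 * pi \<ge> 1" using C1_ge pi_gt_zero by linarith

lemma C2_ge: "C2 \<ge> 3" using C1_pi_ge unfolding C2_def by simp

text \<open>The product up to \<open>N\<close> contains the factor \<open>zero_orbit N\<close>, at
  least c 4^N, while the factors between i and N lose at most 3^N; this leaves room for N^2.\<close>

lemma N0_exists: "\<exists>n0\<ge>2. \<forall>N\<ge>n0. zero_orbit N \<ge> M + N \<and> (\<forall>i<N. 2 * C2 * (real N)\<^sup>2 * zero_orbit_prod i \<le> zero_orbit_prod N)"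
proof -
  obtain c where c: "c > 0" "\<forall>\<^sub>F n in sequentially. zero_orbit n \<ge> c * 4 ^ n" using ro_ge_geometric by blast
  have C: "C2 > 0" using C2_ge by simp
  have "\<forall>\<^sub>F n::nat in sequentially. c * 4 ^ n \<ge> M + n" using c(1) by real_asymp
  moreover have "\<forall>\<^sub>F n::nat in sequentially. c * 4 ^ n \<ge> 2 * C2 * (real n)\<^sup>2 * 3 ^ n"
    using c(1) C by real_asymp
  ultimately have "\<forall>\<^sub>F n in sequentially. zero_orbit n \<ge> M + n \<and> zero_orbit n \<ge> 2 * C2 * (real n)\<^sup>2 * 3 ^ n"
    using c(2) by eventually_elim auto
  then obtain n1 where n1: "\<And>n. n \<ge> n1 \<Longrightarrow> zero_orbit n \<ge> M + n \<and> zero_orbit n \<ge> 2 * C2 * (real n)\<^sup>2 * 3 ^ n"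
    by (auto simp: eventually_sequentially)
  have "2 * C2 * (real N)\<^sup>2 * zero_orbit_prod i \<le> zero_orbit_prod N" if N: "N \<ge> n1" "i < N" for N i
  proof -
    obtain n where n: "N = Suc n" using N(2) by (cases N) auto
    define k where "k = n - i"
    have k: "n = i + k" using N n by (simp add: k_def)
    have "2 * C2 * (real N)\<^sup>2 * zero_orbit_prod i = zero_orbit_prod i * (1/3) ^ N * (2 * C2 * (real N)\<^sup>2 * 3 ^ N)"
      by (simp add: power_one_over)
    also have "\<dots> \<le> zero_orbit_prod i * (1/3) ^ k * zero_orbit N"
    proof (rule mult_mono)
      show "zero_orbit_prod i * (1/3) ^ N \<le> zero_orbit_prod i * (1/3) ^ k"
        using n k by (intro mult_left_mono power_decreasing) auto
    qed (use n1 N C in auto)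
    also have "\<dots> \<le> zero_orbit_prod n * zero_orbit N"
      unfolding k by (rule mult_right_mono[OF Q_ge ro_nonneg])
    finally show ?thesis by (simp add: n zero_orbit_prod_Suc)
  qed
  then show ?thesis using n1 by (intro exI[of _ "max 2 n1"]) auto
qed

definition N0 :: nat where
  "N0 = (SOME n0. n0 \<ge> 2 \<and> (\<forall>N\<ge>n0. zero_orbit N \<ge> M + N \<and> (\<forall>i<N. 2 * C2 * (real N)\<^sup>2 * zero_orbit_prod i \<le> zero_orbit_prod N)))"

lemma N0_ge: "N0 \<ge> 2"
  and ro_N0: "N \<ge> N0 \<Longrightarrow> zero_orbit N \<ge> M + N"
  and Q_N0: "N \<ge> N0 \<Longrightarrow> i < N \<Longrightarrow> 2 * C2 * (real N)\<^sup>2 * zero_orbit_prod i \<le> zero_orbit_prod N"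
  using someI_ex[OF N0_exists, folded N0_def] by blast+

section \<open>Following the singular orbit through a block of zeros\<close>

definition leading_zeros :: "nat \<Rightarrow> (nat \<Rightarrow> int) \<Rightarrow> bool" where
  "leading_zeros N s \<longleftrightarrow> (\<forall>i<N. s i = 0) \<and> s N \<noteq> 0"

lemma Esc_funpow:
  assumes "z \<in> itin s"
  shows "(f ^^ k) z \<in> Esc (shift_seq k s) \<longleftrightarrow> z \<in> Esc s"
proof -
  have *: "(\<forall>\<^sub>F j in sequentially. P ((f ^^ (j + k)) z)) = (\<forall>\<^sub>F j in sequentially. P ((f ^^ j) z))" for P
    by (rule eventually_sequentially_seg[of "\<lambda>j. P ((f ^^ j) z)"])
  have "filterlim (\<lambda>j. (f ^^ (j + k)) z) at_infinity sequentially \<longleftrightarrow>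
    filterlim (\<lambda>j. (f ^^ j) z) at_infinity sequentially"
    unfolding filterlim_iff by (rule all_cong1) (subst *, rule refl)
  moreover have "(f ^^ (j + k)) z = (f ^^ j) ((f ^^ k) z)" for j
    by (simp add: funpow_add)
  ultimately show ?thesis
    using assms itin_funpow[OF assms, of k] unfolding escaping_set_def by simp
qed

text \<open>With relative errors of at most 1 / (2 N), one step distorts the error by a factor of at
  most 1 + 1 / N. This serves both comparisons with the singular orbit.\<close>

lemma Q_small:
  assumes "N \<ge> N0" "i < N" "W \<le> (C1 + 3 * pi) * N" 
  shows "3 * W * zero_orbit_prod i / zero_orbit_prod N \<le> 1 / (2 * real N)"
proof -
  have N: "N > 0" using assms by simp
  have "3 * W * zero_orbit_prod i * (2 * N) \<le> 3 * ((C1 + 3 * pi) * N) * zero_orbit_prod i * (2 * N)"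
    using assms(3) by (intro mult_right_mono mult_left_mono) auto
  also have "\<dots> = 2 * C2 * (real N)\<^sup>2 * zero_orbit_prod i" by (simp add: C2_def power2_eq_square)
  also have "\<dots> \<le> zero_orbit_prod N" using Q_N0 assms by blast
  finally show ?thesis using N by (simp add: field_simps)
qed

lemma one_plus_inverse_power_le_3: "N > 0 \<Longrightarrow> i \<le> N \<Longrightarrow> (1 + 1 / real N) ^ i \<le> 3"
proof -
  assume N: "N > 0" "i \<le> N"
  have "(1 + 1 / real N) ^ i \<le> (1 + 1 / real N) ^ N" using N by (intro power_increasing) auto
  also have "\<dots> \<le> exp 1" using exp_ge_one_plus_x_over_n_power_n[of N 1] N by simp
  also have "\<dots> \<le> 3" by (rule exp_le)
  finally show ?thesis .
qed

text \<open>A point of potential \<open>zero_orbit N\<close> at time \<open>N\<close> lies within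
  \<open>W\<close> of \<open>zero_orbit N\<close>. Pulling it back through \<open>N\<close> branches
  of index 0 divides this distance by \<open>zero_orbit_prod N\<close>, up to a total distortion of
  at most 3.\<close>

lemma close_point:
  assumes "linearly_bounded 0 s" "nonzero_often s" "leading_zeros N s" "N \<ge> N0"
  obtains v where "v \<in> Esc s" "norm v \<le> C2 * \<bar>real_of_int (s N)\<bar> / zero_orbit_prod N"
proof -
  define j where "j = \<bar>real_of_int (s N)\<bar>"
  have j: "1 \<le> j" "j \<le> N" using assms(1,3) by (auto simp: j_def leading_zeros_def linearly_bounded_def)
  have N: "N > 0" using N0_ge assms(4) by simp
  have rn: "nonzero_often (shift_seq N s)" using assms(2) rec_nz_shift by blast
  \<comment> \<open>After the shift the linear bound starts at \<open>N\<close>, which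
    \<open>zero_orbit N \<ge> M + N\<close> can afford.\<close>
  obtain w where w: "near (shift_seq N s) (zero_orbit N) w"
    using near_exists[of "real N" "shift_seq N s" "zero_orbit N"] S_class_shift[OF assms(1), of N] ro_N0[OF assms(4)] by auto
  have wi: "w \<in> itin (shift_seq N s)" using near_itin[OF rn w] .
  have "zero_orbit N > 0" using ro_N0[OF assms(4)] M_ge3 by simp
  then have we: "w \<in> Esc (shift_seq N s)"
    using near_imp_pot[of w "shift_seq N s" 0 "zero_orbit N"] w wi pot_Esc by simp
  obtain v where v: "v \<in> itin s" "(f ^^ N) v = w" using itin_surj[OF assms(2) wi] by blast
  have ve: "v \<in> Esc s" using Esc_funpow[OF v(1), of N] we v(2) by simp
  define e where "e i = norm ((f ^^ i) v - of_real (zero_orbit i))" for i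
  define W where "W = (C1 + 3 * pi) * j"
  have W: "W \<le> (C1 + 3 * pi) * N" "W \<ge> 0" using j C1_ge by (auto simp: W_def intro!: mult_left_mono)
  have eN: "e N \<le> W"
  proof -
    have "\<bar>Re w - zero_orbit N\<bar> \<le> C1" using w unfolding near_def by (metis funpow_0)
    moreover have "w \<in> closed_R (s N)" using itin_cR[OF wi, of 0] by (simp add: shift_apply)
    then have "\<bar>Im w\<bar> \<le> (2 * j + 1) * pi" unfolding j_def by (rule cR_abs_Im)
    moreover have "e N \<le> \<bar>Re w - zero_orbit N\<bar> + \<bar>Im w\<bar>"
      using cmod_le[of "w - of_real (zero_orbit N)"] by (simp add: e_def v(2))
    moreover have "(2 * j + 1) * pi \<le> 3 * j * pi"
      using j by (intro mult_right_mono) auto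
    moreover have "C1 * 1 \<le> C1 * j"
      using j C1_ge by (intro mult_left_mono) auto
    moreover have "W = C1 * j + 3 * j * pi" by (simp add: W_def algebra_simps)
    ultimately show ?thesis by linarith
  qed
  \<comment> \<open>Backward induction: \<open>k\<close> counts the branches already applied, and (1
    + 1/N)^k is the distortion so far.\<close>
  have bound: "e (N - k) \<le> (1 + 1 / N) ^ k * W * zero_orbit_prod (N - k) / zero_orbit_prod N" if "k \<le> N" for k
    using that
  proof (induction k)
    case 0
    then show ?case using eN by simp
  next
    case (Suc k)
    define i where "i = N - Suc k"
    have i: "N - k = Suc i" "i < N" using Suc.prems by (auto simp: i_def)
    define r where "r = zero_orbit (Suc i)"
    have r: "r > 0" by (simp add: r_def)
    define u where "u = (f ^^ i) v"
    \<comment> \<open>The relative error at the image. The error one step earlier is exactly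
      \<open>Ln (1 + x)\<close>, since \<open>lam\<close> cancels in the difference of the two
      logarithms.\<close>
    define x where "x = (f u - of_real r) / of_real r"
    have IH: "e (Suc i) \<le> (1 + 1 / N) ^ k * W * zero_orbit_prod (Suc i) / zero_orbit_prod N"
      using Suc i(1) by simp
    have nx: "norm x = e (Suc i) / r"
      using r by (simp add: x_def e_def norm_divide u_def) (simp add: r_def)
    also have "\<dots> \<le> (1 + 1 / N) ^ k * W * zero_orbit_prod (Suc i) / zero_orbit_prod N / r"
      using divide_right_mono[OF IH, of r] r by simp
    also have "\<dots> = (1 + 1 / N) ^ k * W * zero_orbit_prod i / zero_orbit_prod N"
      using r by (simp add: zero_orbit_prod_Suc flip: r_def)
    finally have x1: "norm x \<le> (1 + 1 / N) ^ k * W * zero_orbit_prod i / zero_orbit_prod N" .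
    also have "\<dots> \<le> 3 * W * zero_orbit_prod i / zero_orbit_prod N"
    proof (rule divide_right_mono[OF mult_right_mono[OF mult_right_mono]])
      show "(1 + 1 / real N) ^ k \<le> 3" using Suc.prems by (intro one_plus_inverse_power_le_3 N) simp
    qed (rule W(2) zero_orbit_prod_nonneg)+
    also have "\<dots> \<le> 1 / (2 * real N)" by (rule Q_small[OF assms(4) i(2) W(1)])
    finally have x2: "norm x \<le> 1 / (2 * real N)" .
    moreover have "1 / (2 * real N) \<le> 1/2" using N by simp
    ultimately have x3: "norm x \<le> 1/2" by linarith
    have "u \<in> R 0" using itin_R[OF v(1), of i] assms(3) i(2) by (simp add: u_def leading_zeros_def)
    then have "u = Ln (f u / of_real lam)" using Lb_f[of u 0] by (simp add: branch_def)
    then have 1: "u = Ln (f u) - of_real (ln lam)" by (simp add: Ln_divide_of_real)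
    have 2: "of_real (zero_orbit i) = Ln (of_real r) - of_real (ln lam)"
      using r by (simp add: Ln_of_real r_def ro_Suc ln_mult del: of_real_mult)
    have "u - of_real (zero_orbit i) = Ln (f u) - Ln (of_real r)"
      using arg_cong2[where f = minus, OF 1 2] by simp
    also have "\<dots> = Ln (1 + x)"
      using r by (simp add: x_def field_simps Ln_divide_of_real flip: Ln_of_real)
    finally have "e i = norm (Ln (1 + x))" by (simp add: e_def u_def)
    also have "\<dots> \<le> norm x * (1 + 2 * norm x)" by (rule norm_Ln_1_le[OF x3])
    also have "\<dots> \<le> ((1 + 1 / N) ^ k * W * zero_orbit_prod i / zero_orbit_prod N) * (1 + 1 / N)"
    proof (rule mult_mono[OF x1])
      show "1 + 2 * norm x \<le> 1 + 1 / real N" using x2 by simp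
      show "0 \<le> (1 + 1 / real N) ^ k * W * zero_orbit_prod i / zero_orbit_prod N" using x1 norm_ge_zero order_trans by blast
    qed simp
    finally show ?case by (simp add: i_def mult_ac)
  qed
  have "norm v \<le> (1 + 1 / N) ^ N * W / zero_orbit_prod N" using bound[of N] by (simp add: e_def)
  also have "\<dots> \<le> 3 * W / zero_orbit_prod N"
    by (rule divide_right_mono[OF mult_right_mono[OF one_plus_inverse_power_le_3[OF N order_refl] W(2)] zero_orbit_prod_nonneg])
  finally show thesis using that[OF ve] by (simp only: W_def C2_def j_def mult.assoc)
qed

text \<open>Put j = |s N|. A point closer to 0 would be within 3 j of the real number
  \<open>zero_orbit N\<close> at time \<open>N\<close>, by the same distortion bound; but its strip
  has distance at least (2 j - 1) \<pi> >= j \<pi> > 3 j from the real axis.\<close>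

lemma itin_norm_ge:
  assumes "linearly_bounded 0 s" "leading_zeros N s" "N \<ge> N0" "w \<in> itin s"
  shows "norm w \<ge> \<bar>real_of_int (s N)\<bar> / zero_orbit_prod N"
proof (rule ccontr)
  define j where "j = \<bar>real_of_int (s N)\<bar>"
  assume "\<not> ?thesis"
  then have w0: "norm w < j / zero_orbit_prod N" by (simp add: j_def)
  have j: "1 \<le> j" "j \<le> N" using assms(1,2) by (auto simp: j_def leading_zeros_def linearly_bounded_def)
  have N: "N > 0" using N0_ge assms(3) by simp
  define e where "e i = norm ((f ^^ i) w - of_real (zero_orbit i))" for i
  have C: "real N \<le> (C1 + 3 * pi) * real N"
    using mult_right_mono[OF C1_pi_ge, of "real N"] by simp
  have bound: "e k \<le> (1 + 1 / N) ^ k * (j / zero_orbit_prod N) * zero_orbit_prod k" if "k \<le> N" for k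
    using that
  proof (induction k)
    case 0
    then show ?case using w0 by (simp add: e_def)
  next
    case (Suc k)
    define u where "u = (f ^^ k) w"
    define x where "x = u - of_real (zero_orbit k)"
    have x1: "norm x \<le> (1 + 1 / N) ^ k * (j / zero_orbit_prod N) * zero_orbit_prod k" using Suc by (simp add: x_def e_def u_def)
    also have "\<dots> \<le> 3 * (j / zero_orbit_prod N) * zero_orbit_prod k"
    proof (rule mult_right_mono[OF mult_right_mono])
      show "(1 + 1 / real N) ^ k \<le> 3" using Suc.prems by (intro one_plus_inverse_power_le_3 N) simp
    qed (use j in simp_all)
    also have "\<dots> = 3 * j * zero_orbit_prod k / zero_orbit_prod N" by simp
    also have "\<dots> \<le> 1 / (2 * real N)"
      using Q_small[OF assms(3), of k j] Suc.prems j C by simp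
    finally have x2: "norm x \<le> 1 / (2 * real N)" .
    moreover have "1 / (2 * real N) \<le> 1/2" using N by simp
    ultimately have x3: "norm x \<le> 1" by linarith
    have "f u - of_real (zero_orbit (Suc k)) = of_real (zero_orbit (Suc k)) * (exp x - 1)"
      by (simp add: E_def ro_Suc x_def exp_diff exp_of_real right_diff_distrib)
    then have "e (Suc k) = zero_orbit (Suc k) * norm (exp x - 1)"
      by (simp add: e_def u_def norm_mult less_imp_le)
    also have "\<dots> \<le> zero_orbit (Suc k) * (norm x * (1 + 2 * norm x))"
      by (intro mult_left_mono norm_exp_m1_le x3) (simp add: less_imp_le)
    also have "\<dots> \<le> zero_orbit (Suc k) * (((1 + 1 / N) ^ k * (j / zero_orbit_prod N) * zero_orbit_prod k) * (1 + 1 / N))"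
    proof (intro mult_left_mono mult_mono x1)
      show "1 + 2 * norm x \<le> 1 + 1 / real N" using x2 by simp
      show "0 \<le> (1 + 1 / real N) ^ k * (j / zero_orbit_prod N) * zero_orbit_prod k" using x1 norm_ge_zero order_trans by blast
    qed (simp_all add: less_imp_le)
    finally show ?case by (simp add: zero_orbit_prod_Suc mult_ac)
  qed
  have "e N \<le> 3 * j"
  proof -
    have "e N \<le> (1 + 1 / N) ^ N * (j / zero_orbit_prod N) * zero_orbit_prod N" using bound by blast
    also have "\<dots> = (1 + 1 / N) ^ N * j" by simp
    also have "\<dots> \<le> 3 * j" using j by (intro mult_right_mono one_plus_inverse_power_le_3 N order_refl) simp
    finally show ?thesis .
  qed
  moreover have "\<bar>Im ((f ^^ N) w)\<bar> \<le> e N"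
    using abs_Im_le_cmod[of "(f ^^ N) w - of_real (zero_orbit N)"] by (simp add: e_def)
  moreover have "(2 * j - 1) * pi \<le> \<bar>Im ((f ^^ N) w)\<bar>"
    unfolding j_def by (rule cR_abs_Im(2)[OF itin_cR[OF assms(4)]])
  moreover have "j * pi \<le> (2 * j - 1) * pi" using j by (intro mult_right_mono) auto
  moreover have "j * 3 < j * pi" using j pi_gt3 by (intro mult_strict_left_mono) auto
  ultimately show False by linarith
qed

text \<open>The bounds of \<open>close_point\<close> and \<open>itin_norm_ge\<close> share the
  factor |s N| / zero_orbit_prod N, so only the constant \<open>C2\<close> remains in the
  comparison.\<close>

lemma close_point_small:
  assumes "linearly_bounded 0 s" "nonzero_often s" "leading_zeros N s" "N \<ge> N0"
  obtains v where "v \<in> Esc s" "norm v \<le> 1 / (2 * real N)" "\<And>w. w \<in> itin s \<Longrightarrow> norm v \<le> C2 * norm w"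
proof -
  obtain v where v: "v \<in> Esc s" "norm v \<le> C2 * \<bar>real_of_int (s N)\<bar> / zero_orbit_prod N"
    using close_point[OF assms] .
  have N: "N > 0" using N0_ge assms(4) by simp
  have j: "\<bar>real_of_int (s N)\<bar> \<le> N" using assms(1) unfolding linearly_bounded_def by (metis add_0)
  have "norm v \<le> 3 * ((C1 + 3 * pi) * \<bar>real_of_int (s N)\<bar>) * zero_orbit_prod 0 / zero_orbit_prod N"
    using v(2) by (simp only: C2_def zero_orbit_prod_0 mult_1_right mult.assoc)
  also have "\<dots> \<le> 1 / (2 * real N)"
    using j C1_pi_ge N Q_small[OF assms(4) N mult_left_mono[OF j, of "C1 + 3 * pi"]] by simp
  finally have "norm v \<le> 1 / (2 * real N)" .
  moreover have "norm v \<le> C2 * norm w" if "w \<in> itin s" for w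
    using v(2) mult_left_mono[OF itin_norm_ge[OF assms(1,3,4) that], of C2] C2_ge by simp
  ultimately show thesis using that v(1) by blast
qed

lemma connected_Esc: "good s \<Longrightarrow> connected (Esc s)"
  using hair_image continuous_hair connected_continuous_image[of "{0<..}" "hair s"] by auto

lemma Esc_unbounded: "good s \<Longrightarrow> \<exists>z\<in>Esc s. norm z \<ge> r"
proof -
  assume g: "good s"
  have "filterlim (\<lambda>\<eta>. norm (hair s \<eta>)) at_top at_top"
    using filterlim_at_infinity_imp_norm_at_top[OF hair_at_infinity[OF g]] .
  then have "\<forall>\<^sub>F \<eta> in at_top. norm (hair s \<eta>) \<ge> r" unfolding filterlim_at_top by blast
  then have "\<forall>\<^sub>F \<eta> in at_top. norm (hair s \<eta>) \<ge> r \<and> \<eta> > 0"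
    using eventually_gt_at_top[of 0] by eventually_elim auto
  then obtain \<eta> where "norm (hair s \<eta>) \<ge> r" "\<eta> > 0"
    using eventually_happens trivial_limit_at_top_linorder by blast
  then show ?thesis unfolding hair_image[OF g, symmetric] by blast
qed

text \<open>The escaping set is connected and unbounded and contains a point of modulus at most C2
  |w|, so its moduli fill an interval from there upwards.\<close>

lemma Esc_comparable_norm:
  assumes "good s" "leading_zeros N s" "N \<ge> N0" "w \<in> itin s"
  obtains v where "v \<in> Esc s" "norm w \<le> norm v" "norm v \<le> C2 * norm w"
proof -
  obtain v0 where v0: "v0 \<in> Esc s" "norm v0 \<le> C2 * norm w"
    using close_point_small[of s N] assms unfolding good_def by blast
  define r where "r = max (norm w) (norm v0)"
  obtain v1 where v1: "v1 \<in> Esc s" "norm v1 \<ge> r" using Esc_unbounded[OF assms(1)] by blast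
  have "connected (norm ` Esc s)"
    by (intro connected_continuous_image connected_Esc assms continuous_intros)
  then have "r \<in> norm ` Esc s"
    using v0(1) v1 unfolding connected_iff_interval by (metis imageI max.cobounded2 r_def)
  then obtain v where "v \<in> Esc s" "norm v = r" by auto
  moreover have "norm w \<le> C2 * norm w" using C2_ge mult_right_mono[of 1 C2 "norm w"] by simp
  ultimately show thesis using that v0(2) by (auto simp: r_def)
qed

section \<open>Contraction of the hyperbolic metric under pull-back\<close>

fun branches :: "nat \<Rightarrow> (nat \<Rightarrow> int) \<Rightarrow> complex \<Rightarrow> complex" where
  "branches 0 s w = w"
| "branches (Suc k) s w = branch (s 0) (branches k (shift_seq 1 s) w)"

text \<open>Bounds the derivative of \<open>branches k s\<close> in the metric |dw| / |Im w| of the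
  upper and lower half-planes; see \<open>br_deriv\<close>.\<close>

definition contraction :: "nat \<Rightarrow> (nat \<Rightarrow> int) \<Rightarrow> real" where
  "contraction k s = (\<Prod>i<k. if s i = 0 then 1 else 1/2)"

lemma kap_Suc: "contraction (Suc k) s = (if s 0 = 0 then 1 else 1/2) * contraction k (shift_seq 1 s)"
  unfolding contraction_def by (subst prod.lessThan_Suc_shift) (simp add: shift_apply)

lemma kap_nonneg: "contraction k s \<ge> 0" by (auto simp: contraction_def intro!: prod_nonneg)

lemma br_funpow: "z \<in> itin s \<Longrightarrow> branches k s ((f ^^ k) z) = z"
proof (induction k arbitrary: s z)
  case (Suc k)
  have z: "f z \<in> itin (shift_seq 1 s)" "z \<in> R (s 0)" using Suc.prems itin_Suc[of z s] by blast+
  then show ?case using Suc.IH[OF z(1)] Lb_f[OF z(2)] unfolding funpow_f_Suc by simp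
qed simp

text \<open>In the metric |dw| / |Im w| the branch has derivative |sin y| / |y|, with y the new
  imaginary part. This is at most 1, and at most 1/2 once |y| >= 2, as in every strip of non-zero
  index.\<close>

lemma Lb_nonreal:
  assumes "Im u \<noteq> 0"
  shows "Im (branch j u) \<noteq> 0" "\<bar>Im u\<bar> / norm u \<le> (if j = 0 then 1 else 1/2) * \<bar>Im (branch j u)\<bar>"
proof -
  define y where "y = Im (branch j u)"
  have u: "u \<noteq> 0" using assms by auto
  then have *: "Im u = norm u * sin y"
    using Im_f[of "branch j u"] norm_f[of "branch j u"] unfolding f_Lb[OF u] y_def by simp
  then show "Im (branch j u) \<noteq> 0" using assms by (auto simp: y_def)
  have s: "\<bar>Im u\<bar> / norm u = \<bar>sin y\<bar>" unfolding * using u by (simp add: abs_mult)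
  show "\<bar>Im u\<bar> / norm u \<le> (if j = 0 then 1 else 1/2) * \<bar>Im (branch j u)\<bar>"
  proof (cases "j = 0")
    case True
    then show ?thesis using s abs_sin_x_le_abs_x[of y] by (simp add: y_def)
  next
    case False
    then have "\<bar>real_of_int j\<bar> \<ge> 1" by linarith
    then have "1 * pi \<le> (2 * \<bar>real_of_int j\<bar> - 1) * pi" by (intro mult_right_mono) auto
    also have "\<dots> \<le> \<bar>y\<bar>" unfolding y_def using Lb_in_R[OF u] R_subset_cR by (intro cR_abs_Im(2)) auto
    finally have "2 \<le> \<bar>y\<bar>" using pi_gt3 by simp
    moreover have "\<bar>sin y\<bar> \<le> 1" by (rule abs_sin_le_one)
    ultimately have "\<bar>sin y\<bar> \<le> 1/2 * \<bar>y\<bar>" by linarith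
    then show ?thesis using s False by (simp add: y_def)
  qed
qed

text \<open>The chain rule for the hyperbolic derivative; non-zero imaginary parts keep all
  intermediate points off the cut of the logarithm.\<close>

lemma br_deriv:
  assumes "Im w \<noteq> 0"
  shows "Im (branches k s w) \<noteq> 0 \<and> (\<exists>d. (branches k s has_field_derivative d) (at w) \<and> norm d * \<bar>Im w\<bar> \<le> contraction k s * \<bar>Im (branches k s w)\<bar>)"
proof (induction k arbitrary: s)
  case 0
  have "branches 0 s = (\<lambda>w. w)" by auto
  then show ?case using assms by (auto simp: contraction_def intro!: exI[of _ 1])
next
  case (Suc k)
  define u where "u = branches k (shift_seq 1 s) w"
  obtain d where u: "Im u \<noteq> 0" and d: "(branches k (shift_seq 1 s) has_field_derivative d) (at w)"
    "norm d * \<bar>Im w\<bar> \<le> contraction k (shift_seq 1 s) * \<bar>Im u\<bar>"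
    using Suc[of "shift_seq 1 s"] by (auto simp: u_def)
  have u0: "u \<noteq> 0" using u by auto
  have "(branch (s 0) has_field_derivative inverse u) (at u)"
    unfolding branch_def using u u0
    by (auto intro!: derivative_eq_intros simp: complex_nonpos_Reals_iff field_simps)
  then have "((\<lambda>w. branch (s 0) (branches k (shift_seq 1 s) w)) has_field_derivative inverse u * d) (at w)"
    using d(1) DERIV_chain2 unfolding u_def by blast
  moreover have "(\<lambda>w. branch (s 0) (branches k (shift_seq 1 s) w)) = branches (Suc k) s" by auto
  moreover have "norm (inverse u * d) * \<bar>Im w\<bar> \<le> contraction (Suc k) s * \<bar>Im (branches (Suc k) s w)\<bar>"
  proof -
    have "norm (inverse u * d) * \<bar>Im w\<bar> = norm d * \<bar>Im w\<bar> / norm u"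
      by (simp add: norm_mult norm_inverse divide_inverse mult_ac)
    also have "\<dots> \<le> contraction k (shift_seq 1 s) * (\<bar>Im u\<bar> / norm u)"
      using divide_right_mono[OF d(2), of "norm u"] by simp
    also have "\<dots> \<le> contraction k (shift_seq 1 s) * ((if s 0 = 0 then 1 else 1/2) * \<bar>Im (branch (s 0) u)\<bar>)"
      using Lb_nonreal(2)[OF u] kap_nonneg by (intro mult_left_mono) auto
    finally show ?thesis by (simp add: kap_Suc u_def mult_ac)
  qed
  ultimately show ?case using Lb_nonreal(1)[OF u, of "s 0"] by (auto simp: u_def)
qed

lemma convex_R: "convex (R j)"
proof -
  have "R j = {z. (2 * of_int j - 1) * pi < Im z} \<inter> {z. Im z \<le> (2 * of_int j + 1) * pi}"
    by (auto simp: R_def)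
  then show ?thesis by (simp add: convex_Int convex_halfspace_Im_gt convex_halfspace_Im_le)
qed

text \<open>Back to the Euclidean metric: |Im w| >= \<pi> throughout the convex strip of non-zero
  index, and the strip of \<open>s 0\<close> bounds the imaginary part at the end. The latter takes
  at least one branch, hence \<open>Suc k\<close>.\<close>

lemma br_dist:
  assumes "j \<noteq> 0" "p \<in> R j" "q \<in> R j"
  shows "norm (branches (Suc k) s p - branches (Suc k) s q) \<le> contraction (Suc k) s * (2 * \<bar>real_of_int (s 0)\<bar> + 1) * norm (p - q)"
proof -
  have im: "\<bar>Im w\<bar> \<ge> pi" if "w \<in> R j" for w
  proof -
    have "\<bar>real_of_int j\<bar> \<ge> 1" using assms(1) by linarith
    then have "1 * pi \<le> (2 * \<bar>real_of_int j\<bar> - 1) * pi" by (intro mult_right_mono) auto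
    also have "\<dots> \<le> \<bar>Im w\<bar>" using that R_subset_cR by (intro cR_abs_Im(2)) auto
    finally show ?thesis by simp
  qed
  have "\<exists>d. (branches (Suc k) s has_field_derivative d) (at w within R j) \<and>
      norm d \<le> contraction (Suc k) s * (2 * \<bar>real_of_int (s 0)\<bar> + 1)" if w: "w \<in> R j" for w
  proof -
    have w0: "Im w \<noteq> 0" using im[OF w] pi_gt_zero by linarith
    obtain d where d: "(branches (Suc k) s has_field_derivative d) (at w)"
      "norm d * \<bar>Im w\<bar> \<le> contraction (Suc k) s * \<bar>Im (branches (Suc k) s w)\<bar>"
      using br_deriv[OF w0] by blast
    have "branches k (shift_seq 1 s) w \<noteq> 0" using br_deriv[OF w0, of k "shift_seq 1 s"] by auto
    then have "branches (Suc k) s w \<in> closed_R (s 0)" using Lb_in_R R_subset_cR by auto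
    then have "\<bar>Im (branches (Suc k) s w)\<bar> \<le> (2 * \<bar>real_of_int (s 0)\<bar> + 1) * pi" by (rule cR_abs_Im)
    then have "norm d * \<bar>Im w\<bar> \<le> contraction (Suc k) s * ((2 * \<bar>real_of_int (s 0)\<bar> + 1) * pi)"
      using d(2) kap_nonneg by (meson mult_left_mono order_trans)
    moreover have "norm d * pi \<le> norm d * \<bar>Im w\<bar>" using im[OF w] by (intro mult_left_mono) auto
    ultimately have "norm d * pi \<le> (contraction (Suc k) s * (2 * \<bar>real_of_int (s 0)\<bar> + 1)) * pi"
      by (simp only: mult.assoc)
    then have "norm d \<le> contraction (Suc k) s * (2 * \<bar>real_of_int (s 0)\<bar> + 1)"
      by (rule mult_right_le_imp_le) simp
    then show ?thesis using d(1) has_field_derivative_at_within by blast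
  qed
  then obtain D where "\<And>w. w \<in> R j \<Longrightarrow> (branches (Suc k) s has_field_derivative D w) (at w within R j) \<and>
      norm (D w) \<le> contraction (Suc k) s * (2 * \<bar>real_of_int (s 0)\<bar> + 1)" by metis
  then show ?thesis
    using field_differentiable_bound[OF convex_R, of j "branches (Suc k) s" D _ p q] assms(2,3) by blast
qed

lemma kap_le_power:
  assumes "nonzero_often s" shows "\<exists>K. \<forall>k\<ge>K. contraction k s \<le> (1/2) ^ n"
proof (induction n)
  case 0
  show ?case by (auto simp: contraction_def intro!: exI[of _ 0] prod_le_1)
next
  case (Suc n)
  then obtain K where K: "\<And>k. k \<ge> K \<Longrightarrow> contraction k s \<le> (1/2) ^ n" by blast
  obtain p where p: "p \<ge> K" "s p \<noteq> 0" using assms nonzero_often_def by blast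
  have "contraction k s \<le> (1/2) ^ Suc n" if "k \<ge> Suc p" for k
    using that
  proof (induction k rule: dec_induct)
    case base
    then show ?case using K[OF p(1)] p(2) by (simp add: contraction_def)
  next
    case (step k)
    have "contraction (Suc k) s \<le> contraction k s" using kap_nonneg[of k s] by (simp add: contraction_def)
    then show ?case using step by linarith
  qed
  then show ?case by blast
qed

text \<open>At such times \<open>k\<close> both ingredients of density meet: a strip away from the
  real axis for \<open>br_dist\<close>, and right after it the block of zeros for
  \<open>Esc_comparable_norm\<close>.\<close>

definition long_gaps :: "(nat \<Rightarrow> int) \<Rightarrow> bool" where
  "long_gaps s \<longleftrightarrow> (\<forall>K. \<exists>k\<ge>K. s k \<noteq> 0 \<and> linearly_bounded 0 (shift_seq (Suc k) s) \<and>
    (\<exists>N\<ge>N0. leading_zeros N (shift_seq (Suc k) s)))"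

lemma good_shift:
  assumes "good s" "linearly_bounded 0 (shift_seq k s)"
  shows "good (shift_seq k s)"
  unfolding good_def
proof (intro conjI allI)
  show "nonzero_often (shift_seq k s)" using assms(1) good_rec_nz rec_nz_shift by blast
  show "linearly_bounded 0 (shift_seq k s)" by fact
  fix m
  obtain i where "i \<ge> k + m" "linearly_bounded 0 (shift_seq i s)" using assms(1) unfolding good_def by blast
  then show "\<exists>i\<ge>m. linearly_bounded 0 (shift_seq i (shift_seq k s))"
    by (intro exI[of _ "i - k"]) simp
qed

lemma Esc_dense:
  assumes "good s" "long_gaps s"
  shows "itin s \<subseteq> closure (Esc s)"
proof
  fix z assume z: "z \<in> itin s"
  have rn: "nonzero_often s" using assms(1) good_rec_nz by blast
  define D where "D = (2 * \<bar>real_of_int (s 0)\<bar> + 1) * (ln C2 + 2 * pi)"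
  have "\<exists>y\<in>Esc s. dist y z < \<epsilon>" if e: "\<epsilon> > 0" for \<epsilon>
  proof -
    have "((\<lambda>n. (1/2) ^ n * D) \<longlongrightarrow> 0) sequentially" by real_asymp
    then obtain n where n: "(1/2) ^ n * D < \<epsilon>"
      using e by (metis (mono_tags, lifting) order_tendstoD(2) eventually_happens sequentially_bot)
    obtain K where K: "\<And>k. k \<ge> K \<Longrightarrow> contraction k s \<le> (1/2) ^ n" using kap_le_power[OF rn] by blast
    \<comment> \<open>Asking for \<open>Suc K\<close> guarantees at least one branch before time
      \<open>k\<close>, as \<open>br_dist\<close> requires.\<close>
    obtain k N where k: "k \<ge> Suc K" "s k \<noteq> 0" "linearly_bounded 0 (shift_seq (Suc k) s)"
       "N \<ge> N0" "leading_zeros N (shift_seq (Suc k) s)"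
      using assms(2) unfolding long_gaps_def by meson
    obtain k' where k': "k = Suc k'" using k(1) by (cases k) auto
    define w where "w = (f ^^ Suc k) z"
    have w: "w \<in> itin (shift_seq (Suc k) s)" using z itin_funpow w_def by blast
    obtain v where v: "v \<in> Esc (shift_seq (Suc k) s)" "norm w \<le> norm v" "norm v \<le> C2 * norm w"
      using Esc_comparable_norm[OF good_shift[OF assms(1) k(3)] k(5,4) w] .
    obtain y where y: "y \<in> itin s" "(f ^^ Suc k) y = v"
      using itin_surj[OF rn Esc_itin[OF v(1)]] by blast
    have yE: "y \<in> Esc s" using Esc_funpow[OF y(1), of "Suc k"] y(2) v(1) by simp
    define p q where "p = (f ^^ k) y" and "q = (f ^^ k) z"
    have pq: "p \<in> R (s k)" "q \<in> R (s k)" using itin_R y(1) z by (auto simp: p_def q_def)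
    have fp: "f p = v" "f q = w" using y(2) by (auto simp: p_def q_def w_def)
    \<comment> \<open>Comparable moduli at time k + 1 mean real parts within ln C2 at time
      k.\<close>
    have "exp (Re q) \<le> exp (Re p)" "exp (Re p) \<le> C2 * exp (Re q)"
      using v(2,3) unfolding fp[symmetric] norm_f by (auto simp: mult.left_commute)
    then have "Re q \<le> Re p" "exp (Re p) \<le> exp (ln C2 + Re q)" using C2_ge by (simp_all add: exp_add)
    then have "\<bar>Re p - Re q\<bar> \<le> ln C2" by simp
    moreover have "\<bar>Im p - Im q\<bar> \<le> 2 * pi" using pq R_subset_cR cR_diff_Im by blast
    ultimately have "norm (p - q) \<le> ln C2 + 2 * pi" using cmod_le[of "p - q"] by simp
    moreover have "norm (branches k s p - branches k s q) \<le> contraction k s * (2 * \<bar>real_of_int (s 0)\<bar> + 1) * norm (p - q)"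
      unfolding k' using br_dist[OF k(2) pq] by blast
    moreover have "branches k s p = y" "branches k s q = z" using br_funpow y(1) z by (auto simp: p_def q_def)
    ultimately have "norm (y - z) \<le> contraction k s * (2 * \<bar>real_of_int (s 0)\<bar> + 1) * (ln C2 + 2 * pi)"
      using kap_nonneg[of k s] by (smt (verit) mult_left_mono mult_nonneg_nonneg)
    also have "\<dots> = contraction k s * D" by (simp add: D_def)
    also have "\<dots> \<le> (1/2) ^ n * D"
      using K[of k] k(1) C2_ge by (intro mult_right_mono) (auto simp: D_def)
    finally have "dist y z < \<epsilon>" using n by (simp add: dist_norm)
    then show ?thesis using yE by blast
  qed
  then show "z \<in> closure (Esc s)" by (simp add: closure_approachable)
qed

end

section \<open>Indecomposability\<close>

definition finite_part :: "complex option set \<Rightarrow> complex set" where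
  "finite_part S = {z. Some z \<in> S}"

lemma topspace_riemann_sphere [simp]: "topspace riemann_sphere = UNIV"
  by (auto simp: riemann_sphere_def) (metis not_None_eq rangeI)

lemma closedin_Some_compact: "compact K \<Longrightarrow> closedin riemann_sphere (Some ` K)"
  by (simp add: riemann_sphere_def compact_imp_closed)

lemma closedin_insert_None: "closed S \<Longrightarrow> closedin riemann_sphere (insert None (Some ` S))"
proof -
  assume "closed S"
  then have o: "openin riemann_sphere (Some ` (- S))"
    by (simp add: riemann_sphere_def open_Compl)
  have e: "UNIV - insert None (Some ` S) = Some ` (- S)"
  proof (rule set_eqI)
    show "x \<in> UNIV - insert None (Some ` S) \<longleftrightarrow> x \<in> Some ` (- S)" for x
      by (cases x) auto
  qed
  show ?thesis unfolding closedin_def topspace_riemann_sphere e using o by blast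
qed

lemma closedin_sphereD:
  assumes "closedin riemann_sphere C"
  shows "closed (finite_part C)" "None \<notin> C \<Longrightarrow> compact (finite_part C)"
proof -
  consider K where "compact K" "C = Some ` K" | U where "open U" "C = UNIV - Some ` U"
    using assms topspace_riemann_sphere
    unfolding riemann_sphere_def closedin_Alexandroff_compactification by auto
  then have "closed (finite_part C) \<and> (None \<notin> C \<longrightarrow> compact (finite_part C))"
  proof cases
    case 1
    then have "finite_part C = K" by (auto simp: finite_part_def)
    then show ?thesis using 1 by (simp add: compact_imp_closed)
  next
    case 2
    then have "finite_part C = - U" by (auto simp: finite_part_def)
    then show ?thesis using 2 by auto
  qed
  then show "closed (finite_part C)" "None \<notin> C \<Longrightarrow> compact (finite_part C)" by auto
qed

lemma closedin_sphere_closure: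
  assumes "closedin riemann_sphere C" "Some ` S \<subseteq> C"
  shows "Some ` closure S \<subseteq> C" "\<not> bounded S \<Longrightarrow> None \<in> C"
proof -
  have S: "S \<subseteq> finite_part C" using assms(2) by (auto simp: finite_part_def)
  then have "closure S \<subseteq> finite_part C" using closedin_sphereD(1)[OF assms(1)] by (rule closure_minimal)
  then show "Some ` closure S \<subseteq> C" by (auto simp: finite_part_def)
  show "None \<in> C" if "\<not> bounded S"
    using closedin_sphereD(2)[OF assms(1)] S that compact_imp_bounded bounded_subset by blast
qed

lemma compactin_sphere_iff: "compactin riemann_sphere S \<longleftrightarrow> closedin riemann_sphere S"
proof
  have "Hausdorff_space riemann_sphere"
    by (simp add: riemann_sphere_def Hausdorff_space_Alexandroff_compactification locally_compact_space_euclidean)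
  then show "compactin riemann_sphere S \<Longrightarrow> closedin riemann_sphere S"
    using compactin_imp_closedin by blast
  show "closedin riemann_sphere S \<Longrightarrow> compactin riemann_sphere S"
    by (intro closedin_compact_space) (simp_all add: riemann_sphere_def)
qed

lemma continuous_map_Some_sphere: "continuous_map euclidean riemann_sphere Some"
  by (simp add: riemann_sphere_def continuous_map_Some)

lemma connectedin_Some: "connected S \<Longrightarrow> connectedin riemann_sphere (Some ` S)"
  using connectedin_continuous_map_image[OF continuous_map_Some_sphere] by simp

text \<open>An unbounded set has \<infinity> in its closure on the sphere, and every set between a
  connected set and its closure is connected.\<close>

lemma connectedin_Some_between:
  assumes "connected S" "\<not> bounded S" "S \<subseteq> T" "T \<subseteq> closure S"
  shows "connectedin riemann_sphere (insert None (Some ` T))"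
proof (rule connectedin_intermediate_closure_of[OF connectedin_Some[OF assms(1)]])
  have "closedin riemann_sphere (riemann_sphere closure_of (Some ` S))" by simp
  moreover have sub: "Some ` S \<subseteq> riemann_sphere closure_of (Some ` S)"
    by (rule closure_of_subset) simp
  ultimately show "insert None (Some ` T) \<subseteq> riemann_sphere closure_of (Some ` S)"
    using closedin_sphere_closure[OF _ sub] assms by blast
qed (use assms in auto)

text \<open>An omitted level cuts \<open>C\<close> into two relatively closed parts: the sublevel
  set is compact, hence closed in the sphere, and \<infinity> belongs to the other part.\<close>

lemma connectedin_sphere_split:
  fixes \<phi> :: "complex \<Rightarrow> real"
  assumes "connectedin riemann_sphere C" "finite_part C \<subseteq> S" "closed S" "continuous_on S \<phi>"
    and "compact {z\<in>S. \<phi> z \<le> r}" "\<And>z. z \<in> finite_part C \<Longrightarrow> \<phi> z \<noteq> r"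
  shows "C \<subseteq> Some ` {z\<in>S. \<phi> z < r} \<or> C \<subseteq> insert None (Some ` {z\<in>S. \<phi> z > r})"
proof -
  let ?E = "Some ` {z\<in>S. \<phi> z \<le> r}" and ?F = "insert None (Some ` {z\<in>S. \<phi> z \<ge> r})"
  have "{z\<in>S. \<phi> z \<ge> r} = S \<inter> \<phi> -` {r..}" by auto
  then have "closed {z\<in>S. \<phi> z \<ge> r}"
    using continuous_closed_preimage[OF assms(4,3) closed_atLeast, of r] by simp
  then have "closedin riemann_sphere ?E" "closedin riemann_sphere ?F"
    using closedin_Some_compact[OF assms(5)] closedin_insert_None by blast+
  moreover have mem: "x = None \<or> (\<exists>z\<in>S. x = Some z \<and> \<phi> z \<noteq> r)" if "x \<in> C" for x
    using that assms(2,6) by (cases x) (auto simp: finite_part_def)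
  have "x \<in> ?E \<union> ?F \<and> x \<notin> ?E \<inter> ?F" if "x \<in> C" for x
    using mem[OF that] by (cases x) (auto simp: image_iff)
  then have "C \<subseteq> ?E \<union> ?F" "?E \<inter> ?F \<inter> C = {}" by blast+
  ultimately have "?E \<inter> C = {} \<or> ?F \<inter> C = {}"
    using assms(1) unfolding connectedin_closedin by blast
  then show ?thesis
  proof
    assume e: "?E \<inter> C = {}"
    have "x \<in> insert None (Some ` {z\<in>S. \<phi> z > r})" if "x \<in> C" for x
    proof (cases x)
      case (Some z)
      then have "z \<in> S" using mem[OF that] by auto
      moreover have "\<not> \<phi> z \<le> r" using e that Some \<open>z \<in> S\<close> by blast
      ultimately show ?thesis using Some by auto
    qed simp
    then show ?thesis by blast
  next
    assume e: "?F \<inter> C = {}"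
    have "x \<in> Some ` {z\<in>S. \<phi> z < r}" if "x \<in> C" for x
    proof (cases x)
      case (Some z)
      then have "z \<in> S" using mem[OF that] by auto
      moreover have "\<not> \<phi> z \<ge> r" using e that Some \<open>z \<in> S\<close> by blast
      ultimately show ?thesis using Some by auto
    qed (use e that in blast)
    then show ?thesis by blast
  qed
qed

section \<open>Separation by levels of the real part of an iterate\<close>

context expo begin

lemma norm_funpow_le: "norm ((f ^^ k) z) \<le> ((\<lambda>x. lam * exp x) ^^ k) (norm z)"
proof (induction k)
  case (Suc k)
  have "norm (f ((f ^^ k) z)) \<le> lam * exp (norm ((f ^^ k) z))"
    using complex_Re_le_cmod[of "(f ^^ k) z"] by (simp add: norm_f)
  also have "\<dots> \<le> lam * exp (((\<lambda>x. lam * exp x) ^^ k) (norm z))" using Suc by simp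
  finally show ?case by simp
qed simp

text \<open>Only one orbit is assumed to lie far to the right. By induction the images are at
  distance at most 2 \<pi>, so the other image has real part at least 2 and the expansion applies to
  both.\<close>

lemma expansion_bound:
  assumes "z \<in> itin s" "w \<in> itin s" "\<And>j. j \<le> n \<Longrightarrow> Re ((f ^^ j) z) \<ge> 2 * pi + 2"
    "norm ((f ^^ n) z - (f ^^ n) w) \<le> 2 * pi"
  shows "norm (z - w) \<le> 2 * pi / 2 ^ n"
  using assms
proof (induction n arbitrary: z w s)
  case (Suc n)
  have z: "f z \<in> itin (shift_seq 1 s)" "z \<in> R (s 0)" using Suc.prems(1) itin_Suc[of z s] by blast+
  have w: "f w \<in> itin (shift_seq 1 s)" "w \<in> R (s 0)" using Suc.prems(2) itin_Suc[of w s] by blast+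
  have d: "norm (f z - f w) \<le> 2 * pi / 2 ^ n"
  proof (rule Suc.IH[OF z(1) w(1)])
    show "Re ((f ^^ j) (f z)) \<ge> 2 * pi + 2" if "j \<le> n" for j
      using Suc.prems(3)[of "Suc j"] that unfolding funpow_f_Suc by simp
    show "norm ((f ^^ n) (f z) - (f ^^ n) (f w)) \<le> 2 * pi"
      using Suc.prems(4) unfolding funpow_f_Suc .
  qed
  also have "\<dots> \<le> 2 * pi / 1" by (intro divide_left_mono) auto
  finally have "norm (f z - f w) \<le> 2 * pi" by simp
  then have "\<bar>Re (f z) - Re (f w)\<bar> \<le> 2 * pi" using abs_Re_le_cmod[of "f z - f w"] by simp
  moreover have "Re (f z) \<ge> 2 * pi + 2" using Suc.prems(3)[of 1] by simp
  ultimately have "norm (z - w) \<le> norm (f z - f w) / 2"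
    using pi_gt_zero by (intro f_expands[OF z(2) w(2)]) linarith+
  then show ?case using d by simp
qed simp

text \<open>Points with equal real part at time \<open>k\<close> are within 2 \<pi> there, by the
  height of the strip. Pulling back to a fixed time \<open>J\<close> divides this by 2^(k - J), and
  continuity of the inverse handles the first \<open>J\<close> steps.\<close>

lemma Esc_separates:
  assumes "nonzero_often s" "a \<in> Esc s" "\<epsilon> > 0"
  shows "\<forall>\<^sub>F k in sequentially. \<forall>b\<in>itin s. Re ((f ^^ k) b) = Re ((f ^^ k) a) \<longrightarrow> dist b a < \<epsilon>"
proof -
  have a: "a \<in> itin s" using assms(2) by (rule Esc_itin)
  obtain J where J: "\<And>j. j \<ge> J \<Longrightarrow> Re ((f ^^ j) a) \<ge> 2 * pi + 2"
    using Esc_Re_at_top[OF assms(2)] unfolding filterlim_at_top eventually_sequentially by blast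
  obtain \<delta> where d: "\<delta> > 0" "\<forall>w\<in>itin s. dist ((f ^^ J) w) ((f ^^ J) a) < \<delta> \<longrightarrow> dist w a < \<epsilon>"
    using itin_inverse_continuous[OF assms(1) a assms(3)] by blast
  have l: "((\<lambda>n. 2 * pi / 2 ^ n) \<longlongrightarrow> 0) sequentially" by real_asymp
  obtain n0 where n0: "\<And>n. n \<ge> n0 \<Longrightarrow> 2 * pi / 2 ^ n < \<delta>"
    using order_tendstoD(2)[OF l d(1)] unfolding eventually_sequentially by blast
  have "dist b a < \<epsilon>" if k: "k \<ge> J + n0" and b: "b \<in> itin s" and eq: "Re ((f ^^ k) b) = Re ((f ^^ k) a)" for k b
  proof -
    define n where "n = k - J"
    have kn: "k = J + n" "n \<ge> n0" using k by (auto simp: n_def)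
    have "norm ((f ^^ J) a - (f ^^ J) b) \<le> 2 * pi / 2 ^ n"
    proof (rule expansion_bound[OF itin_funpow[OF a] itin_funpow[OF b]])
      show "Re ((f ^^ j) ((f ^^ J) a)) \<ge> 2 * pi + 2" for j
        using J[of "J + j"] by (simp add: funpow_f_add)
      show "norm ((f ^^ n) ((f ^^ J) a) - (f ^^ n) ((f ^^ J) b)) \<le> 2 * pi"
        using norm_diff_itin[OF a b, of k] eq by (simp add: kn(1) funpow_f_add)
    qed
    then have "dist ((f ^^ J) b) ((f ^^ J) a) < \<delta>" using n0[OF kn(2)] by (simp add: dist_norm norm_minus_commute)
    then show ?thesis using d(2) b by blast
  qed
  then show ?thesis unfolding eventually_sequentially by blast
qed

text \<open>The shifted itinerary set is closed and omits 0, so |f z| is bounded below; this bounds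
  Re z from below, and the induction bounds it from above.\<close>

lemma bounded_itin_preimage: "nonzero_often s \<Longrightarrow> bounded {z\<in>itin s. norm ((f ^^ k) z) \<le> \<rho>}"
proof (induction k arbitrary: s)
  case 0
  show ?case by (rule bounded_subset[OF bounded_cball[of 0 \<rho>]]) auto
next
  case (Suc k)
  have rn: "nonzero_often (shift_seq 1 s)" using Suc.prems rec_nz_shift by blast
  obtain B where B: "\<And>w. w \<in> itin (shift_seq 1 s) \<Longrightarrow> norm ((f ^^ k) w) \<le> \<rho> \<Longrightarrow> norm w \<le> B"
    using Suc.IH[OF rn] unfolding bounded_iff by blast
  have "open (- itin (shift_seq 1 s))" using closed_itin[OF rn] by blast
  moreover have "0 \<in> - itin (shift_seq 1 s)" using itin_nonzero[OF rn, of 0] by blast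
  ultimately obtain c where c: "c > 0" "ball 0 c \<subseteq> - itin (shift_seq 1 s)"
    using open_contains_ball by blast
  have "norm z \<le> \<bar>ln (c / lam)\<bar> + \<bar>ln (B / lam)\<bar> + (2 * \<bar>real_of_int (s 0)\<bar> + 1) * pi"
    if z: "z \<in> itin s" "norm ((f ^^ Suc k) z) \<le> \<rho>" for z
  proof -
    have fz: "f z \<in> itin (shift_seq 1 s)" using z(1) itin_Suc[of z s] by blast
    have 1: "norm (f z) \<le> B" using B[OF fz] z(2) unfolding funpow_f_Suc .
    have 2: "norm (f z) \<ge> c"
      using c(2) fz by (metis ComplD mem_ball_0 not_le subsetD)
    have "ln (c / lam) \<le> Re z" "Re z \<le> ln (B / lam)"
    proof -
      have "Re z = ln (norm (f z) / lam)" by (simp add: norm_f)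
      moreover have "norm (f z) > 0" by simp
      ultimately show "ln (c / lam) \<le> Re z" "Re z \<le> ln (B / lam)"
        using 1 2 c(1) by (simp_all add: divide_right_mono less_le_trans[OF c(1)])
    qed
    then have "\<bar>Re z\<bar> \<le> \<bar>ln (c / lam)\<bar> + \<bar>ln (B / lam)\<bar>" by linarith
    moreover have "\<bar>Im z\<bar> \<le> (2 * \<bar>real_of_int (s 0)\<bar> + 1) * pi"
      using cR_abs_Im(1) itin_cR[OF z(1), of 0] by simp
    ultimately show ?thesis using cmod_le[of z] by linarith
  qed
  then show ?case unfolding bounded_iff by blast
qed

lemma compact_itin_Re_le:
  assumes "nonzero_often s" shows "compact {z\<in>itin s. Re ((f ^^ k) z) \<le> r}"
proof -
  have "{z\<in>itin s. Re ((f ^^ k) z) \<le> r} \<subseteq> {z\<in>itin s. norm ((f ^^ Suc k) z) \<le> lam * exp r}"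
    by (auto simp: norm_f)
  then have "bounded {z\<in>itin s. Re ((f ^^ k) z) \<le> r}"
    using bounded_itin_preimage[OF assms] bounded_subset by blast
  moreover have "{z\<in>itin s. Re ((f ^^ k) z) \<le> r} = itin s \<inter> {z. Re ((f ^^ k) z) \<le> r}" by auto
  moreover have "closed {z. Re ((f ^^ k) z) \<le> r}"
    by (intro closed_Collect_le continuous_intros continuous_funpow_f)
  ultimately show ?thesis
    using closed_itin[OF assms] by (simp add: compact_eq_bounded_closed closed_Int)
qed

text \<open>The iterates of lam exp x from q dominate the orbit of every \<open>a\<close> with |a|
  <= q, so the points can be found after an escaping \<open>a\<close> has been fixed. The zero entry
  gives |Im| <= \<pi> at time k + 1.\<close>

definition reaches_left :: "(nat \<Rightarrow> int) \<Rightarrow> bool" where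
  "reaches_left s \<longleftrightarrow> (\<forall>q::nat. \<exists>k\<ge>q. s (Suc k) = 0 \<and>
     (\<exists>z\<in>itin s. Re ((f ^^ k) z) \<le> 0) \<and>
     (\<exists>z\<in>itin s. Re ((f ^^ Suc k) z) < - ((\<lambda>x. lam * exp x) ^^ Suc k) (real q)))"

lemma no_decomposition:
  assumes s: "good s" "reaches_left s" "itin s \<subseteq> closure (Esc s)"
    and A: "continuum_in riemann_sphere A" "A \<subset> with_infinity (itin s)" "None \<in> A"
    and B: "continuum_in riemann_sphere B" "B \<subset> with_infinity (itin s)"
    and AB: "with_infinity (itin s) = A \<union> B"
  shows False
proof -
  define g where "g = (\<lambda>x. lam * exp x)"
  have rn: "nonzero_often s" using s(1) good_rec_nz by blast
  have unb: "\<not> bounded (Esc s)"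
    unfolding bounded_iff using Esc_unbounded[OF s(1)] by (metis gt_ex not_le less_le_trans)
  have fin: "finite_part A \<subseteq> itin s" "finite_part B \<subseteq> itin s"
    using A(2) B(2) by (auto simp: finite_part_def with_infinity_def)
  have un: "z \<in> finite_part A \<or> z \<in> finite_part B" if "z \<in> itin s" for z
  proof -
    have "Some z \<in> A \<union> B" using that unfolding AB[symmetric] by (simp add: with_infinity_def)
    then show ?thesis by (auto simp: finite_part_def)
  qed
  have cl: "closedin riemann_sphere A" "closedin riemann_sphere B"
    using A(1) B(1) by (auto simp: continuum_in_def compactin_sphere_iff)
  \<comment> \<open>Escaping points are dense and unbounded, so a closed set containing them all
    contains \<open>with_infinity (itin s)\<close>.\<close>
  have *: "\<exists>a\<in>Esc s. a \<notin> finite_part C"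
    if "closedin riemann_sphere C" "C \<subset> with_infinity (itin s)" for C
  proof (rule ccontr)
    assume "\<not> ?thesis"
    then have "Some ` Esc s \<subseteq> C" by (auto simp: finite_part_def)
    then have "Some ` itin s \<subseteq> C" "None \<in> C"
      using closedin_sphere_closure[OF that(1)] s(3) unb by blast+
    then show False using that(2) by (auto simp: with_infinity_def)
  qed
  obtain a where a: "a \<in> Esc s" "a \<notin> finite_part B" using *[OF cl(2) B(2)] by blast
  obtain b where b: "b \<in> Esc s" "b \<notin> finite_part A" using *[OF cl(1) A(2)] by blast
  obtain \<epsilon> where e: "\<epsilon> > 0" "\<And>z. dist z a < \<epsilon> \<Longrightarrow> z \<notin> finite_part B"
    using closedin_sphereD(1)[OF cl(2)] a(2) unfolding closed_def open_dist by auto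
  obtain \<epsilon>' where e': "\<epsilon>' > 0" "\<And>z. dist z b < \<epsilon>' \<Longrightarrow> z \<notin> finite_part A"
    using closedin_sphereD(1)[OF cl(1)] b(2) unfolding closed_def open_dist by auto
  have "\<forall>\<^sub>F k in sequentially. Re ((f ^^ k) a) > 0"
    using Esc_Re_at_top[OF a(1)] unfolding filterlim_at_top_dense by blast
  \<comment> \<open>The threshold ln (\<pi> / lam) makes the modulus exceed \<pi> one step
    later.\<close>
  moreover have "\<forall>\<^sub>F k in sequentially. Re ((f ^^ k) b) > ln (pi / lam) \<and> Re ((f ^^ k) b) > 0"
    using Esc_Re_at_top[OF b(1)] unfolding filterlim_at_top_dense by (intro eventually_conj) blast+
  ultimately have "\<forall>\<^sub>F k in sequentially. Re ((f ^^ k) a) > 0 \<and>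
      Re ((f ^^ k) b) > ln (pi / lam) \<and> Re ((f ^^ k) b) > 0 \<and>
      (\<forall>z\<in>itin s. Re ((f ^^ k) z) = Re ((f ^^ k) a) \<longrightarrow> dist z a < \<epsilon>) \<and>
      (\<forall>z\<in>itin s. Re ((f ^^ k) z) = Re ((f ^^ k) b) \<longrightarrow> dist z b < \<epsilon>')"
    using Esc_separates[OF rn a(1) e(1)] Esc_separates[OF rn b(1) e'(1)] by eventually_elim blast
  then obtain K where K: "\<And>k. k \<ge> K \<Longrightarrow> Re ((f ^^ k) a) > 0 \<and>
      Re ((f ^^ k) b) > ln (pi / lam) \<and> Re ((f ^^ k) b) > 0 \<and>
      (\<forall>z\<in>itin s. Re ((f ^^ k) z) = Re ((f ^^ k) a) \<longrightarrow> dist z a < \<epsilon>) \<and>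
      (\<forall>z\<in>itin s. Re ((f ^^ k) z) = Re ((f ^^ k) b) \<longrightarrow> dist z b < \<epsilon>')"
    unfolding eventually_sequentially by blast
  \<comment> \<open>Here q >= K makes both separations hold at time \<open>k\<close>, and q >= |a|
    bounds the level \<open>r\<close> at that time.\<close>
  obtain q :: nat where q: "q \<ge> K" "real q \<ge> norm a"
    by (metis max.cobounded1 max.cobounded2 order_trans real_arch_simple of_nat_le_iff)
  obtain k z0 z1 where k: "k \<ge> q" "s (Suc k) = 0" and z0: "z0 \<in> itin s" "Re ((f ^^ k) z0) \<le> 0"
    and z1: "z1 \<in> itin s" "Re ((f ^^ Suc k) z1) < - (g ^^ Suc k) (real q)"
    using s(2) unfolding reaches_left_def g_def by meson
  note Kk = K[OF order_trans[OF q(1) k(1)]]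
  define r r' where "r = Re ((f ^^ k) a)" and "r' = Re ((f ^^ k) b)"
  have r: "r > 0" "r' > 0" "r' > ln (pi / lam)" using Kk by (auto simp: r_def r'_def)
  have "mono g" by (auto simp: g_def mono_def)
  then have "(g ^^ k) (norm a) \<le> (g ^^ k) (real q)" using q(2) by (rule funpow_mono)
  moreover have "r \<le> (g ^^ k) (norm a)"
    using norm_funpow_le[of k a] complex_Re_le_cmod[of "(f ^^ k) a"] by (simp add: r_def g_def)
  ultimately have "lam * exp r \<le> (g ^^ Suc k) (real q)" by (simp add: g_def)
  then have "lam * exp r < norm ((f ^^ Suc k) z1)"
    using z1(2) abs_Re_le_cmod[of "(f ^^ Suc k) z1"] by linarith
  then have z1r: "Re ((f ^^ k) z1) > r" by (simp add: norm_f)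
  have Bne: "Re ((f ^^ k) z) \<noteq> r" if "z \<in> finite_part B" for z
    using Kk e(2) that fin(2) unfolding r_def by blast
  have Ane: "Re ((f ^^ k) z) \<noteq> r'" if "z \<in> finite_part A" for z
    using Kk e'(2) that fin(1) unfolding r'_def by blast
  have cont: "continuous_on (itin s) (\<lambda>z. Re ((f ^^ j) z))" for j
    by (intro continuous_intros continuous_funpow_f)
  note split = connectedin_sphere_split[OF _ _ closed_itin[OF rn] cont compact_itin_Re_le[OF rn]]
  have conn: "connectedin riemann_sphere A" "connectedin riemann_sphere B"
    using A(1) B(1) by (auto simp: continuum_in_def)
  have Ag: "Re ((f ^^ k) z) > r'" if "z \<in> finite_part A" for z
    using split[OF conn(1) fin(1), of k r'] Ane A(3) that by (auto simp: finite_part_def)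
  \<comment> \<open>The witness lies left of both levels: it is not in \<open>A\<close>, and it
    decides on which side of level \<open>r\<close> the set \<open>B\<close> lies.\<close>
  then have "z0 \<in> finite_part B" using un z0 r(2) by force
  moreover have "B \<subseteq> Some ` {z\<in>itin s. Re ((f ^^ k) z) < r} \<or> B \<subseteq> insert None (Some ` {z\<in>itin s. Re ((f ^^ k) z) > r})"
    using split[OF conn(2) fin(2), of k r] Bne by blast
  ultimately have "B \<subseteq> Some ` {z\<in>itin s. Re ((f ^^ k) z) < r}"
    using z0(2) r(1) by (auto simp: finite_part_def)
  then have "z1 \<notin> finite_part B" using z1r by (auto simp: finite_part_def)
  then have z1A: "z1 \<in> finite_part A" using un z1(1) by blast
  \<comment> \<open>At time k + 1 the strip has index 0, so a point on the imaginary axis has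
    modulus at most \<pi>, while the points of \<open>A\<close> have modulus above \<pi>.\<close>
  have "Re ((f ^^ Suc k) z) \<noteq> 0" if z: "z \<in> finite_part A" for z
  proof
    assume re: "Re ((f ^^ Suc k) z) = 0"
    have zi: "z \<in> itin s" using z fin by blast
    have "\<bar>Im ((f ^^ Suc k) z)\<bar> \<le> pi"
      using cR_abs_Im(1)[OF itin_cR[OF zi, of "Suc k"]] k(2) by simp
    then have n: "norm ((f ^^ Suc k) z) \<le> pi" using cmod_le[of "(f ^^ Suc k) z"] re by linarith
    have "ln (pi / lam) < Re ((f ^^ k) z)" using r(3) Ag[OF z] by linarith
    then have "exp (ln (pi / lam)) < exp (Re ((f ^^ k) z))" by (simp only: exp_less_cancel_iff)
    then have "pi / lam < exp (Re ((f ^^ k) z))" by (subst (asm) exp_ln) simp_all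
    then have "pi < lam * exp (Re ((f ^^ k) z))" by (simp add: pos_divide_less_eq mult.commute)
    then show False using n by (simp add: norm_f)
  qed
  then have "A \<subseteq> insert None (Some ` {z\<in>itin s. Re ((f ^^ Suc k) z) > 0})"
    using split[OF conn(1) fin(1), of "Suc k" 0] A(3) by blast
  then have "Re ((f ^^ Suc k) z1) > 0" using z1A by (auto simp: finite_part_def)
  moreover have "(g ^^ Suc k) (real q) \<ge> 0" by (simp add: g_def)
  ultimately show False using z1(2) by linarith
qed

lemma continuum_itin:
  assumes "good s" "itin s \<subseteq> closure (Esc s)"
  shows "continuum_in riemann_sphere (with_infinity (itin s))"
  unfolding continuum_in_def compactin_sphere_iff with_infinity_def
proof (intro conjI)
  show "closedin riemann_sphere (insert None (Some ` itin s))"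
    by (intro closedin_insert_None closed_itin good_rec_nz assms)
  have unb: "\<not> bounded (Esc s)"
    unfolding bounded_iff using Esc_unbounded[OF assms(1)] by (metis gt_ex not_le less_le_trans)
  show "connectedin riemann_sphere (insert None (Some ` itin s))"
    by (rule connectedin_Some_between[OF connected_Esc[OF assms(1)] unb _ assms(2)])
      (auto simp: Esc_itin)
qed simp

theorem indecomposable_itin:
  assumes "good s" "reaches_left s" "itin s \<subseteq> closure (Esc s)"
  shows "indecomposable_continuum_in riemann_sphere (with_infinity (itin s))"
  unfolding indecomposable_continuum_in_def
proof (intro conjI notI)
  show "continuum_in riemann_sphere (with_infinity (itin s))" using continuum_itin assms by blast
  assume "\<exists>A B. continuum_in riemann_sphere A \<and> continuum_in riemann_sphere B \<and>
    A \<subset> with_infinity (itin s) \<and> B \<subset> with_infinity (itin s) \<and> with_infinity (itin s) = A \<union> B"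
  then obtain A B where AB: "continuum_in riemann_sphere A" "continuum_in riemann_sphere B"
    "A \<subset> with_infinity (itin s)" "B \<subset> with_infinity (itin s)" "with_infinity (itin s) = A \<union> B" by blast
  have "None \<in> A \<union> B" unfolding AB(5)[symmetric] by (simp add: with_infinity_def)
  then show False
    using no_decomposition[OF assms AB(1,3) _ AB(2,4,5)]
      no_decomposition[OF assms AB(2,4) _ AB(1,3)] AB(5) by (metis Un_commute Un_iff)
qed

end

section \<open>The accumulation set\<close>

text \<open>Near a given finite point the curve is met only at bounded parameters, so only a compact
  arc matters there.\<close>

lemma closed_image_atLeast:
  fixes \<gamma> :: "real \<Rightarrow> complex"
  assumes "continuous_on {e..} \<gamma>" "filterlim \<gamma> at_infinity at_top"
  shows "closed (\<gamma> ` {e..})"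
proof -
  have "l \<in> \<gamma> ` {e..}" if l: "l \<in> closure (\<gamma> ` {e..})" for l
  proof -
    have "\<forall>\<^sub>F t in at_top. norm (\<gamma> t) \<ge> norm l + 1"
      using filterlim_at_infinity_imp_norm_at_top[OF assms(2)] unfolding filterlim_at_top by blast
    then obtain T where T: "\<And>t. t \<ge> T \<Longrightarrow> norm (\<gamma> t) \<ge> norm l + 1"
      unfolding eventually_at_top_linorder by blast
    have "continuous_on {e..T} \<gamma>" using assms(1) by (rule continuous_on_subset) auto
    then have "closed (\<gamma> ` {e..T})" by (intro compact_imp_closed compact_continuous_image) auto
    moreover have "l \<in> closure (\<gamma> ` {e..T})"
      unfolding closure_approachable
    proof (intro allI impI)
      fix d :: real assume "d > 0"
      then obtain y where y: "y \<in> \<gamma> ` {e..}" "dist y l < min d 1"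
        using l unfolding closure_approachable by (metis min_less_iff_conj zero_less_one)
      then obtain t where t: "t \<ge> e" "y = \<gamma> t" by auto
      have "norm y < norm l + 1" using y(2) norm_triangle_ineq2[of y l] by (simp add: dist_norm)
      then have "t \<le> T" using T[of t] t(2) by force
      then show "\<exists>y\<in>\<gamma> ` {e..T}. dist y l < d" using t y(2) by auto
    qed
    ultimately have "l \<in> \<gamma> ` {e..T}" by simp
    then show ?thesis by auto
  qed
  then have "closure (\<gamma> ` {e..}) \<subseteq> \<gamma> ` {e..}" by blast
  then show ?thesis using closure_subset_eq by blast
qed

lemma unbounded_image_at_infinity:
  fixes \<gamma> :: "real \<Rightarrow> complex"
  assumes "filterlim \<gamma> at_infinity at_top"
  shows "\<not> bounded (\<gamma> ` {e..})"
proof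
  assume "bounded (\<gamma> ` {e..})"
  then obtain B where B: "\<And>t. t \<ge> e \<Longrightarrow> norm (\<gamma> t) \<le> B" unfolding bounded_iff by auto
  have "\<forall>\<^sub>F t in at_top. norm (\<gamma> t) \<ge> B + 1"
    using filterlim_at_infinity_imp_norm_at_top[OF assms] unfolding filterlim_at_top by blast
  then obtain T where "\<And>t. t \<ge> T \<Longrightarrow> norm (\<gamma> t) \<ge> B + 1"
    unfolding eventually_at_top_linorder by blast
  from this[of "max e T"] B[of "max e T"] show False by simp
qed

lemma image_atLeast_continuum:
  fixes \<gamma> :: "real \<Rightarrow> complex"
  assumes "continuous_on {e..} \<gamma>" "filterlim \<gamma> at_infinity at_top"
  shows "continuum_in riemann_sphere (insert None (Some ` \<gamma> ` {e..}))"
  unfolding continuum_in_def compactin_sphere_iff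
proof (intro conjI)
  show "closedin riemann_sphere (insert None (Some ` \<gamma> ` {e..}))"
    by (rule closedin_insert_None[OF closed_image_atLeast[OF assms]])
  have "connected (\<gamma> ` {e..})" using assms(1) by (intro connected_continuous_image) auto
  then show "connectedin riemann_sphere (insert None (Some ` \<gamma> ` {e..}))"
    by (rule connectedin_Some_between[OF _ unbounded_image_at_infinity[OF assms(2)] order_refl closure_subset])
qed simp

text \<open>The closure of the initial piece and the closed tail with \<infinity> cover the
  continuum. The tail cannot be everything, since it is itself decomposable into a compact arc and a
  later tail.\<close>

lemma ray_start_dense:
  fixes \<gamma> :: "real \<Rightarrow> complex"
  assumes cont: "continuous_on {0<..} \<gamma>" and inj: "inj_on \<gamma> {0<..}"
    and inf: "filterlim \<gamma> at_infinity at_top"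
    and ind: "indecomposable_continuum_in riemann_sphere (with_infinity (closure (\<gamma> ` {0<..})))"
    and e: "e > 0"
  shows "riemann_sphere closure_of (Some ` \<gamma> ` {0<..e}) = with_infinity (closure (\<gamma> ` {0<..}))"
proof -
  define X where "X = with_infinity (closure (\<gamma> ` {0<..}))"
  define A where "A = riemann_sphere closure_of (Some ` \<gamma> ` {0<..e})"
  define B where "B e' = insert None (Some ` \<gamma> ` {e'..})" for e'
  have clA: "closedin riemann_sphere A" by (simp add: A_def)
  have subA: "Some ` \<gamma> ` {0<..e} \<subseteq> A" unfolding A_def by (rule closure_of_subset) simp
  have clX: "closedin riemann_sphere X"
    unfolding X_def with_infinity_def by (rule closedin_insert_None) simp
  have sub: "Some (\<gamma> t) \<in> X" if "t > 0" for t
    using that closure_subset[of "\<gamma> ` {0<..}"] unfolding X_def with_infinity_def by blast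
  have "Some ` \<gamma> ` {0<..e} \<subseteq> X" using sub by auto
  then have AX: "A \<subseteq> X" unfolding A_def by (rule closure_of_minimal[OF _ clX])
  have BX: "B e' \<subseteq> X" if "e' > 0" for e' using sub that by (auto simp: B_def) (simp add: X_def with_infinity_def)
  have contB: "continuous_on {e'..} \<gamma>" if "e' > 0" for e'
    using cont by (rule continuous_on_subset) (use that in auto)
  have B: "continuum_in riemann_sphere (B e')" if "e' > 0" for e'
    unfolding B_def by (rule image_atLeast_continuum[OF contB[OF that] inf])
  have A: "continuum_in riemann_sphere A"
    unfolding continuum_in_def compactin_sphere_iff
  proof (intro conjI clA)
    have "\<gamma> e \<in> \<gamma> ` {0<..e}" using e by auto
    then show "A \<noteq> {}" using subA by blast
    have "connected (\<gamma> ` {0<..e})"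
      by (intro connected_continuous_image continuous_on_subset[OF cont]) auto
    then show "connectedin riemann_sphere A"
      unfolding A_def by (intro connectedin_closure_of connectedin_Some)
  qed
  have "X \<subseteq> A \<union> B e"
  proof -
    have "{0<..} = {0<..e} \<union> {e..}" using e by auto
    then have "\<gamma> ` {0<..} = \<gamma> ` {0<..e} \<union> \<gamma> ` {e..}" by (metis image_Un)
    then have "Some ` \<gamma> ` {0<..} \<subseteq> A \<union> B e" using subA unfolding B_def by auto
    moreover have "closedin riemann_sphere (A \<union> B e)"
      using clA B[OF e] unfolding continuum_in_def compactin_sphere_iff by (intro closedin_Un) auto
    ultimately have "Some ` closure (\<gamma> ` {0<..}) \<subseteq> A \<union> B e" using closedin_sphere_closure(1) by blast
    moreover have "None \<in> B e" by (simp add: B_def)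
    ultimately show ?thesis unfolding X_def with_infinity_def by blast
  qed
  then have "X = A \<union> B e" using AX BX[OF e] by blast
  then have "A = X \<or> B e = X"
    using ind A B[OF e] AX BX[OF e] unfolding indecomposable_continuum_in_def X_def[symmetric] by blast
  moreover have "B e \<noteq> X"
  proof
    assume BXe: "B e = X"
    \<comment> \<open>The arc is proper because it misses \<infinity>; the later tail is proper
      because, by injectivity, it misses \<open>\<gamma> e\<close>.\<close>
    define A' where "A' = Some ` \<gamma> ` {e..e + 1}"
    have c: "continuous_on {e..e + 1} \<gamma>" using cont by (rule continuous_on_subset) (use e in auto)
    have A': "continuum_in riemann_sphere A'"
      unfolding continuum_in_def compactin_sphere_iff A'_def
      by (intro conjI closedin_Some_compact connectedin_Some compact_continuous_image connected_continuous_image c) auto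
    have "{e..} = {e..e + 1} \<union> {e + 1..}" by auto
    then have "\<gamma> ` {e..} = \<gamma> ` {e..e + 1} \<union> \<gamma> ` {e + 1..}" by (metis image_Un)
    then have XU: "X = A' \<union> B (e + 1)" unfolding BXe[symmetric] B_def A'_def by auto
    have "None \<in> X" "None \<notin> A'" unfolding BXe[symmetric] by (auto simp: B_def A'_def)
    then have "A' \<subset> X" using XU by blast
    moreover have "\<gamma> e \<notin> \<gamma> ` {e + 1..}"
    proof
      assume "\<gamma> e \<in> \<gamma> ` {e + 1..}"
      then obtain t where "t \<ge> e + 1" "\<gamma> e = \<gamma> t" by auto
      then show False using inj_onD[OF inj, of e t] e by simp
    qed
    then have "Some (\<gamma> e) \<notin> B (e + 1)" by (auto simp: B_def)
    moreover have "Some (\<gamma> e) \<in> X" unfolding BXe[symmetric] B_def by auto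
    ultimately have "B (e + 1) \<subset> X" using XU by blast
    moreover have "continuum_in riemann_sphere (B (e + 1))" using B e by simp
    ultimately show False
      using ind A' \<open>A' \<subset> X\<close> XU unfolding indecomposable_continuum_in_def X_def[symmetric] by blast
  qed
  ultimately show ?thesis by (simp add: A_def X_def)
qed

text \<open>Since every initial piece is dense, each n admits a parameter of at most 1 / (n + 1)
  whose point is within 1 / (n + 1) of a finite limit, or of modulus at least n when the limit is
  \<infinity>.\<close>

lemma accumulation_set_ray:
  fixes \<gamma> :: "real \<Rightarrow> complex"
  assumes cont: "continuous_on {0<..} \<gamma>" and inj: "inj_on \<gamma> {0<..}"
    and inf: "filterlim \<gamma> at_infinity at_top"
    and ind: "indecomposable_continuum_in riemann_sphere (with_infinity (closure (\<gamma> ` {0<..})))"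
  shows "accumulation_set \<gamma> = with_infinity (closure (\<gamma> ` {0<..}))"
proof (intro equalityI subsetI)
  fix l assume "l \<in> accumulation_set \<gamma>"
  then obtain \<eta> where \<eta>: "\<And>n. \<eta> n > 0" "limitin riemann_sphere (\<lambda>n. Some (\<gamma> (\<eta> n))) l sequentially"
    by (auto simp: accumulation_set_def)
  have "closedin riemann_sphere (with_infinity (closure (\<gamma> ` {0<..})))"
    unfolding with_infinity_def by (rule closedin_insert_None) simp
  moreover have "Some (\<gamma> (\<eta> n)) \<in> with_infinity (closure (\<gamma> ` {0<..}))" for n
    using \<eta>(1)[of n] closure_subset[of "\<gamma> ` {0<..}"] unfolding with_infinity_def by blast
  ultimately show "l \<in> with_infinity (closure (\<gamma> ` {0<..}))"
    using limitin_closedin[OF \<eta>(2)] by simp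
next
  fix l assume l: "l \<in> with_infinity (closure (\<gamma> ` {0<..}))"
  have cl: "l \<in> riemann_sphere closure_of (Some ` \<gamma> ` {0<..e})" if "e > 0" for e
    using ray_start_dense[OF assms that] l by simp
  have pos: "inverse (real (Suc n)) > 0" for n by simp
  have tends: "(\<lambda>n. inverse (real (Suc n))) \<longlonglongrightarrow> 0" by (rule LIMSEQ_inverse_real_of_nat)
  show "l \<in> accumulation_set \<gamma>"
  proof (cases l)
    case None
    have "\<exists>y\<in>{0<..inverse (real (Suc n))}. norm (\<gamma> y) \<ge> real n" for n
    proof (rule ccontr)
      assume "\<not> ?thesis"
      then have "\<gamma> ` {0<..inverse (real (Suc n))} \<subseteq> cball 0 (real n)" by force
      then have "Some ` \<gamma> ` {0<..inverse (real (Suc n))} \<subseteq> Some ` cball 0 (real n)" by blast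
      then have "riemann_sphere closure_of (Some ` \<gamma> ` {0<..inverse (real (Suc n))}) \<subseteq> Some ` cball 0 (real n)"
        by (rule closure_of_minimal[OF _ closedin_Some_compact]) simp
      then show False using cl[OF pos, of n] None by blast
    qed
    then obtain \<eta> where \<eta>: "\<And>n. \<eta> n \<in> {0<..inverse (real (Suc n))}" "\<And>n. norm (\<gamma> (\<eta> n)) \<ge> real n"
      by metis
    have "limitin riemann_sphere (\<lambda>n. Some (\<gamma> (\<eta> n))) None sequentially"
      unfolding limitin_def
    proof (intro conjI allI impI)
      fix U assume U: "openin riemann_sphere U \<and> None \<in> U"
      then have "closedin riemann_sphere (UNIV - U)" by (simp add: openin_closedin_eq)
      then have "compact (finite_part (UNIV - U))" by (rule closedin_sphereD(2)) (use U in simp)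
      then obtain B where B: "\<And>z. z \<in> finite_part (UNIV - U) \<Longrightarrow> norm z \<le> B"
        using compact_imp_bounded[of "finite_part (UNIV - U)"] unfolding bounded_iff by blast
      obtain n0 :: nat where n0: "real n0 > B" using reals_Archimedean2 by blast
      have "Some (\<gamma> (\<eta> n)) \<in> U" if "n \<ge> n0" for n
      proof (rule ccontr)
        assume "Some (\<gamma> (\<eta> n)) \<notin> U"
        then have "norm (\<gamma> (\<eta> n)) \<le> B" by (intro B) (simp add: finite_part_def)
        then show False using \<eta>(2)[of n] n0 that by simp
      qed
      then show "\<forall>\<^sub>F n in sequentially. Some (\<gamma> (\<eta> n)) \<in> U" unfolding eventually_sequentially by blast
    qed simp
    moreover have "\<eta> \<longlonglongrightarrow> 0"
      by (rule tendsto_sandwich[OF _ _ tendsto_const tends]) (use \<eta>(1) in \<open>auto intro!: always_eventually simp: less_imp_le\<close>)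
    moreover have "\<eta> n > 0" for n using \<eta>(1)[of n] by simp
    ultimately show ?thesis unfolding accumulation_set_def None by blast
  next
    case (Some z)
    have "\<exists>y\<in>{0<..inverse (real (Suc n))}. dist (\<gamma> y) z < inverse (real (Suc n))" for n
    proof -
      have "openin riemann_sphere (Some ` ball z (inverse (real (Suc n))))"
        by (simp add: riemann_sphere_def)
      moreover have "l \<in> Some ` ball z (inverse (real (Suc n)))" using Some by auto
      ultimately obtain x where x: "x \<in> Some ` \<gamma> ` {0<..inverse (real (Suc n))}" "x \<in> Some ` ball z (inverse (real (Suc n)))"
        using cl[OF pos, of n] unfolding in_closure_of by blast
      then obtain y where "y \<in> {0<..inverse (real (Suc n))}" "x = Some (\<gamma> y)" by blast
      moreover then have "\<gamma> y \<in> ball z (inverse (real (Suc n)))" using x(2) by blast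
      ultimately show ?thesis by (intro bexI[of _ y]) (simp_all add: dist_commute)
    qed
    then obtain \<eta> where \<eta>: "\<And>n. \<eta> n \<in> {0<..inverse (real (Suc n))}" "\<And>n. dist (\<gamma> (\<eta> n)) z < inverse (real (Suc n))"
      by metis
    have "(\<lambda>n. dist (\<gamma> (\<eta> n)) z) \<longlonglongrightarrow> 0"
      by (rule tendsto_sandwich[OF _ _ tendsto_const tends])
        (use \<eta>(2) in \<open>auto intro!: always_eventually simp: less_imp_le\<close>)
    then have "limitin euclidean (\<lambda>n. \<gamma> (\<eta> n)) z sequentially"
      unfolding limitin_canonical_iff by (rule tendsto_dist_iff[THEN iffD2])
    then have "limitin riemann_sphere (\<lambda>n. Some (\<gamma> (\<eta> n))) l sequentially"
      using continuous_map_limit[OF continuous_map_Some_sphere] by (simp add: Some o_def)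
    moreover have "\<eta> \<longlonglongrightarrow> 0"
      by (rule tendsto_sandwich[OF _ _ tendsto_const tends]) (use \<eta>(1) in \<open>auto intro!: always_eventually simp: less_imp_le\<close>)
    moreover have "\<eta> n > 0" for n using \<eta>(1)[of n] by simp
    ultimately show ?thesis unfolding accumulation_set_def by blast
  qed
qed

context expo begin

text \<open>If the escaping set has an endpoint \<open>\<gamma> 0\<close>, continuity makes it a
  limit of the open hair, so both cases of \<open>is_hair\<close> give the same closure.\<close>

lemma is_hair_closure:
  assumes "is_hair lam s \<gamma>" "nonzero_often s" "itin s \<subseteq> closure (Esc s)"
  shows "closure (\<gamma> ` {0<..}) = itin s" "continuous_on {0<..} \<gamma>" "inj_on \<gamma> {0<..}"
proof -
  have *: "continuous_on {0<..} \<gamma> \<and> inj_on \<gamma> {0<..} \<and> \<gamma> ` {0<..} \<subseteq> Esc s \<and> Esc s \<subseteq> closure (\<gamma> ` {0<..})"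
    using assms(1) unfolding is_hair_def
  proof (elim conjE disjE)
    assume "\<gamma> ` {0<..} = Esc s" "continuous_on {0<..} \<gamma>" "inj_on \<gamma> {0<..}"
    then show ?thesis using closure_subset[of "\<gamma> ` {0<..}"] by simp
  next
    assume h: "\<gamma> ` {0..} = Esc s" "continuous_on {0..} \<gamma>" "inj_on \<gamma> {0..}"
    have sub: "{0<..} \<subseteq> {0::real..}" by auto
    have "\<gamma> ` closure {0<..} \<subseteq> closure (\<gamma> ` {0<..})"
      by (rule image_closure_subset[OF _ closed_closure closure_subset]) (use h(2) in simp)
    then have "Esc s \<subseteq> closure (\<gamma> ` {0<..})" using h(1) by simp
    then show ?thesis
      using h continuous_on_subset[OF h(2) sub] inj_on_subset[OF h(3) sub] image_mono[OF sub, of \<gamma>] by simp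
  qed
  then show "continuous_on {0<..} \<gamma>" "inj_on \<gamma> {0<..}" by auto
  have "closure (\<gamma> ` {0<..}) \<subseteq> itin s"
    using * Esc_itin closed_itin[OF assms(2)] by (intro closure_minimal) auto
  moreover have "itin s \<subseteq> closure (\<gamma> ` {0<..})"
    using * assms(3) closure_minimal[of "Esc s" "closure (\<gamma> ` {0<..})"] by auto
  ultimately show "closure (\<gamma> ` {0<..}) = itin s" by blast
qed

theorem good_itinerary:
  assumes "good s" "long_gaps s" "reaches_left s"
  shows "(\<exists>\<gamma>. is_hair lam s \<gamma>) \<and>
    (\<forall>\<gamma>. is_hair lam s \<gamma> \<longrightarrow>
       with_infinity (itin_set lam s) = with_infinity (closure (\<gamma> ` {0<..})) \<and>
       with_infinity (closure (\<gamma> ` {0<..})) = accumulation_set \<gamma>) \<and>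
    indecomposable_continuum_in riemann_sphere (with_infinity (itin_set lam s))"
proof -
  have dense: "itin s \<subseteq> closure (Esc s)" using Esc_dense assms(1,2) by blast
  have ind: "indecomposable_continuum_in riemann_sphere (with_infinity (itin s))"
    using indecomposable_itin assms(1,3) dense by blast
  have "with_infinity (itin s) = with_infinity (closure (\<gamma> ` {0<..})) \<and>
       with_infinity (closure (\<gamma> ` {0<..})) = accumulation_set \<gamma>" if h: "is_hair lam s \<gamma>" for \<gamma>
  proof -
    note c = is_hair_closure[OF h good_rec_nz[OF assms(1)] dense]
    have "filterlim \<gamma> at_infinity at_top" using h by (simp add: is_hair_def)
    then show ?thesis using accumulation_set_ray[OF c(2,3)] ind by (simp add: c(1))
  qed
  then show ?thesis using is_hair_hair[OF assms(1)] ind by blast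
qed

end

section \<open>The choice of the sequence\<close>

lemma flat_snth_block:
  assumes "\<And>i. ws !! i \<noteq> []" "i < length (ws !! q)"
  shows "flat ws !! ((\<Sum>p<q. length (ws !! p)) + i) = (ws !! q) ! i"
  using assms
proof (induction q arbitrary: ws)
  case 0
  have "shd ws \<noteq> []" using 0(1)[of 0] by simp
  then show ?case using 0(2) by (simp add: flat_unfold shift_snth_less)
next
  case (Suc q)
  have "shd ws \<noteq> []" using Suc.prems(1)[of 0] by simp
  then have "flat ws !! (length (shd ws) + n) = flat (stl ws) !! n" for n
    by (simp add: flat_unfold shift_snth_ge)
  moreover have "(\<Sum>p<Suc q. length (ws !! p)) = length (shd ws) + (\<Sum>p<q. length (stl ws !! p))"
    by (subst sum.lessThan_Suc_shift) simp
  moreover have "flat (stl ws) !! ((\<Sum>p<q. length (stl ws !! p)) + i) = (stl ws !! q) ! i"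
    using Suc.prems(1)[of "Suc _"] Suc.prems(2) by (intro Suc.IH) auto
  ultimately show ?case by (simp add: add.assoc)
qed

text \<open>Here \<open>m q\<close> is the position where the \<open>q\<close>-th block of zeros
  starts. The successor in \<open>n_N0\<close> and the summand 1 in \<open>n_t\<close> are slack for
  starting one place inside the block; \<open>n_exp\<close> produces the point far to the left in
  \<open>reaches_left\<close>.\<close>

locale padded = expo +
  fixes t :: "nat \<Rightarrow> int list" and n :: "nat \<Rightarrow> nat" and m :: "nat \<Rightarrow> nat"
  assumes t_nz: "\<And>q. \<exists>x\<in>set (t q). x \<noteq> 0"
    and m_0: "m 0 = 0" and m_Suc: "\<And>q. m (Suc q) = m q + n q + length (t q)"
    and n_N0: "\<And>q. n q \<ge> Suc N0"
    and n_t: "\<And>q x. x \<in> set (t q) \<Longrightarrow> \<bar>x\<bar> + 1 \<le> int (n q)"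
    and n_exp: "\<And>q. 2 * lam * (real (n q) - 1) > exp (((\<lambda>x. lam * exp x) ^^ m q) (real q))"
begin

definition s :: "nat \<Rightarrow> int" where "s = zero_padded_concat n t"

lemma s_block:
  assumes "i < n q + length (t q)"
  shows "s (m q + i) = (replicate (n q) 0 @ t q) ! i"
proof -
  define ws where "ws = smap (\<lambda>q. replicate (n q) 0 @ t q) nats"
  have ws: "ws !! q = replicate (n q) 0 @ t q" for q by (simp add: ws_def)
  have m: "m q = (\<Sum>p<q. length (ws !! p))" for q
    by (induction q) (simp_all add: m_0 m_Suc ws)
  have "ws !! i \<noteq> []" for i using t_nz[of i] by (auto simp: ws)
  then have "flat ws !! (m q + i) = (ws !! q) ! i"
    unfolding m by (rule flat_snth_block) (use assms in \<open>simp add: ws\<close>)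
  then show ?thesis by (simp add: s_def zero_padded_concat_def ws_def)
qed

lemma s_zero: "i < n q \<Longrightarrow> s (m q + i) = 0"
  by (simp add: s_block nth_append)

lemma m_ge: "m q \<ge> q"
proof (induction q)
  case (Suc q)
  then show ?case using n_N0[of q] by (simp add: m_Suc)
qed simp

lemma s_nonzero: "\<exists>p. m q + n q \<le> p \<and> p < m (Suc q) \<and> s p \<noteq> 0"
proof -
  obtain i where i: "i < length (t q)" "t q ! i \<noteq> 0" using t_nz[of q] by (auto simp: in_set_conv_nth)
  then have "s (m q + (n q + i)) \<noteq> 0" by (subst s_block) (simp_all add: nth_append)
  then show ?thesis using i by (intro exI[of _ "m q + (n q + i)"]) (simp add: m_Suc)
qed

lemma block_of: "m q \<le> p \<Longrightarrow> \<exists>q'\<ge>q. m q' \<le> p \<and> p < m (Suc q')"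
proof -
  assume p: "m q \<le> p"
  define q' where "q' = (LEAST r. p < m (Suc r))"
  have ex: "p < m (Suc p)" using m_ge[of "Suc p"] by simp
  then have 1: "p < m (Suc q')" unfolding q'_def by (rule LeastI)
  have "m q' \<le> p"
  proof (cases q')
    case (Suc r)
    then have "\<not> p < m (Suc r)" using not_less_Least[of r "\<lambda>r. p < m (Suc r)"] by (simp add: q'_def)
    then show ?thesis using Suc by simp
  qed (simp add: m_0)
  moreover have "q' \<ge> q"
  proof (rule ccontr)
    assume "\<not> q' \<ge> q"
    then have "Suc q' \<le> q" by simp
    moreover have "mono m" by (rule incseq_SucI) (simp add: m_Suc)
    ultimately have "m (Suc q') \<le> m q" by (auto dest: monoD)
    then show False using 1 p by simp
  qed
  ultimately show ?thesis using 1 by blast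
qed

text \<open>A non-zero entry belongs to some \<open>t q'\<close> with q' >= q, where
  \<open>n_t\<close> bounds it by the length of the zeros in front, all of which lie at or after
  \<open>m q\<close>.\<close>

lemma s_bound:
  assumes "m q \<le> p" "s p \<noteq> 0"
  shows "\<bar>real_of_int (s p)\<bar> + 1 \<le> real (p - m q)" "p \<ge> m q + n q"
proof -
  obtain q' where q': "q' \<ge> q" "m q' \<le> p" "p < m (Suc q')" using block_of[OF assms(1)] by blast
  have "mono m" by (rule incseq_SucI) (simp add: m_Suc)
  then have mm: "m q \<le> m q'" using q'(1) by (rule monoD)
  define i where "i = p - m q'"
  have i: "p = m q' + i" "i < n q' + length (t q')" using q' by (auto simp: i_def m_Suc)
  have ni: "n q' \<le> i" using s_zero[of i q'] assms(2) i(1) by (cases "i < n q'") auto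
  have "s p = t q' ! (i - n q')" unfolding i(1) using i(2) ni by (simp add: s_block nth_append)
  moreover have "i - n q' < length (t q')" using i(2) ni by simp
  ultimately have "s p \<in> set (t q')" by simp
  then have "\<bar>s p\<bar> + 1 \<le> int (n q')" by (rule n_t)
  then have "\<bar>s p\<bar> + 1 \<le> int (p - m q)" using ni i(1) mm by linarith
  then have "real_of_int (\<bar>s p\<bar> + 1) \<le> real_of_int (int (p - m q))" by (simp only: of_int_le_iff)
  then show "\<bar>real_of_int (s p)\<bar> + 1 \<le> real (p - m q)" by simp
  show "p \<ge> m q + n q"
  proof (rule ccontr)
    assume "\<not> p \<ge> m q + n q"
    then have "p - m q < n q" "p = m q + (p - m q)" using assms(1) by auto
    then show False using s_zero[of "p - m q" q] assms(2) by simp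
  qed
qed

text \<open>Starting at m q + 1 uses up the spare 1 in \<open>s_bound\<close>; an earlier start
  among zeros only weakens the requirement.\<close>

lemma S_class_before:
  assumes "k \<le> Suc (m q)" "\<And>p. k \<le> p \<Longrightarrow> p < m q \<Longrightarrow> s p = 0"
  shows "linearly_bounded 0 (shift_seq k s)"
  unfolding linearly_bounded_def shift_apply
proof (intro conjI allI)
  fix j
  show "\<bar>real_of_int (s (k + j))\<bar> \<le> 0 + real j"
  proof (cases "s (k + j) = 0")
    case False
    then have "m q \<le> k + j" using assms(2)[of "k + j"] by force
    from s_bound(1)[OF this False] show ?thesis using assms(1) \<open>m q \<le> k + j\<close>
      by (simp add: of_nat_diff)
  qed simp
qed simp

lemma rec_nz_s: "nonzero_often s"
  unfolding nonzero_often_def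
proof
  fix k
  show "\<exists>p\<ge>k. s p \<noteq> 0" using s_nonzero[of k] m_ge[of k] by (meson le_add1 order_trans)
qed

lemma good_s: "good s"
  unfolding good_def
proof (intro conjI allI rec_nz_s)
  show "linearly_bounded 0 s" using S_class_before[of 0 0] by (simp add: m_0)
  show "\<exists>k\<ge>i. linearly_bounded 0 (shift_seq k s)" for i
    using S_class_before[of "m i" i] m_ge[of i] by (intro exI[of _ "m i"]) simp
qed

text \<open>Only a lower bound for \<open>N\<close> is claimed, because \<open>t q\<close> may
  itself begin with zeros.\<close>

lemma leading_zeros_s:
  assumes "k \<le> Suc (m q)" "\<And>p. k \<le> p \<Longrightarrow> p < m q \<Longrightarrow> s p = 0"
  obtains N where "leading_zeros N (shift_seq k s)" "k + N \<ge> m q + n q"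
proof -
  define P where "P = (LEAST p. m q \<le> p \<and> s p \<noteq> 0)"
  have "\<exists>p. m q \<le> p \<and> s p \<noteq> 0" using s_nonzero[of q] by (meson le_add1 order_trans)
  then have P: "m q \<le> P" "s P \<noteq> 0" unfolding P_def by (metis (mono_tags, lifting) LeastI_ex)+
  have z: "s p = 0" if "m q \<le> p" "p < P" for p
    using not_less_Least[of p "\<lambda>p. m q \<le> p \<and> s p \<noteq> 0"] that by (auto simp: P_def)
  have Pn: "P \<ge> m q + n q" using s_bound(2)[OF P] .
  moreover have "n q \<ge> 1" using n_N0[of q] by simp
  ultimately have "k \<le> P" using assms(1) by linarith
  then have "leading_zeros (P - k) (shift_seq k s)"
    using P z assms(2) unfolding leading_zeros_def shift_apply by (auto simp: not_less) (metis le_add1 less_diff_conv not_less add.commute)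
  then show thesis using that[of "P - k"] Pn \<open>k \<le> P\<close> by simp
qed

lemma long_gaps_s: "long_gaps s"
  unfolding long_gaps_def
proof
  fix K
  define S where "S = {k. k < m (Suc K) \<and> s k \<noteq> 0}"
  obtain p where p: "m K + n K \<le> p" "p < m (Suc K)" "s p \<noteq> 0" using s_nonzero by blast
  have fin: "finite S" "p \<in> S" using p by (auto simp: S_def)
  \<comment> \<open>The last non-zero entry before the block of zeros with number
    \<open>Suc K\<close>; only zeros lie between it and that block.\<close>
  define k where "k = Max S"
  have "k \<in> S" using Max_in[OF fin(1)] fin(2) by (auto simp: k_def)
  then have k: "k < m (Suc K)" "s k \<noteq> 0" by (auto simp: S_def)
  have "p \<le> k" using fin by (simp add: k_def)
  then have "K \<le> k" using p(1) m_ge[of K] by linarith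
  have z: "s i = 0" if "Suc k \<le> i" "i < m (Suc K)" for i
  proof (rule ccontr)
    assume "s i \<noteq> 0"
    then have "i \<le> k" using that(2) fin(1) by (simp add: k_def S_def)
    then show False using that(1) by simp
  qed
  have le: "Suc k \<le> Suc (m (Suc K))" using k(1) by simp
  obtain N where N: "leading_zeros N (shift_seq (Suc k) s)" "Suc k + N \<ge> m (Suc K) + n (Suc K)"
    using leading_zeros_s[OF le z] by blast
  have "N \<ge> N0" using N(2) k(1) n_N0[of "Suc K"] by linarith
  then show "\<exists>k\<ge>K. s k \<noteq> 0 \<and> linearly_bounded 0 (shift_seq (Suc k) s) \<and>
      (\<exists>N\<ge>N0. leading_zeros N (shift_seq (Suc k) s))"
    using \<open>K \<le> k\<close> k(2) S_class_before[OF le z] N(1) by blast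
qed

lemma reaches_left_s: "reaches_left s"
  unfolding reaches_left_def
proof
  fix q
  define r where "r = Suc q"
  \<comment> \<open>Block \<open>r\<close> starts at time k + 1. A small point at time k + 1 will
    yield \<open>z0\<close>, and one at time k + 2 will yield \<open>z1\<close>.\<close>
  obtain k where k: "m r = Suc k" using m_ge[of r] by (cases "m r") (auto simp: r_def)
  have kq: "k \<ge> q" using m_ge[of r] k by (simp add: r_def)
  have n: "n r \<ge> Suc N0" "N0 \<ge> 2" using n_N0 N0_ge by blast+
  have sk: "s (Suc k) = 0" using s_zero[of 0 r] n(1) k by simp
  have le: "Suc k \<le> Suc (m r)" "Suc (Suc k) \<le> Suc (m r)" using k by simp_all
  have z: "s p = 0" if "Suc k \<le> p" "p < m r" for p using that k by simp
  have z': "s p = 0" if "Suc (Suc k) \<le> p" "p < m r" for p using that k by simp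
  obtain N where N: "leading_zeros N (shift_seq (Suc k) s)" "Suc k + N \<ge> m r + n r"
    using leading_zeros_s[OF le(1) z] by blast
  obtain N' where N': "leading_zeros N' (shift_seq (Suc (Suc k)) s)" "Suc (Suc k) + N' \<ge> m r + n r"
    using leading_zeros_s[OF le(2) z'] by blast
  have NN: "N \<ge> N0" "N' \<ge> N0" "real N' \<ge> real (n r) - 1" using N(2) N'(2) n k by simp_all
  obtain v where v: "v \<in> Esc (shift_seq (Suc k) s)" "norm v \<le> 1 / (2 * real N)"
    using close_point_small[OF S_class_before[OF le(1) z] rec_nz_shift[OF rec_nz_s] N(1) NN(1)] by blast
  obtain w where w: "w \<in> Esc (shift_seq (Suc (Suc k)) s)" "norm w \<le> 1 / (2 * real N')"
    using close_point_small[OF S_class_before[OF le(2) z'] rec_nz_shift[OF rec_nz_s] N'(1) NN(2)] by blast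
  obtain z0 where z0: "z0 \<in> itin s" "(f ^^ Suc k) z0 = v"
    using itin_surj[OF rec_nz_s Esc_itin[OF v(1)]] by blast
  obtain z1 where z1: "z1 \<in> itin s" "(f ^^ Suc (Suc k)) z1 = w"
    using itin_surj[OF rec_nz_s Esc_itin[OF w(1)]] by blast
  have "Re ((f ^^ k) z0) \<le> 0"
  proof -
    \<comment> \<open>Now 1 / (2 N) <= 1/4 < 1/3 < lam, so the real part one step earlier is at most
      0.\<close>
    have "1 / (2 * real N) \<le> 1 / (2 * 2)" using NN(1) n(2) by (intro divide_left_mono) auto
    moreover have "lam * exp (Re ((f ^^ k) z0)) \<le> 1 / (2 * real N)"
      using v(2) z0(2) by (auto simp: norm_f)
    ultimately have "lam * exp (Re ((f ^^ k) z0)) \<le> lam * 1"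
      using lam_third by linarith
    then have "exp (Re ((f ^^ k) z0)) \<le> 1" by (simp only: mult_le_cancel_left_pos[OF lam_pos(1)])
    then show ?thesis by simp
  qed
  moreover have "Re ((f ^^ Suc k) z1) < - ((\<lambda>x. lam * exp x) ^^ Suc k) (real q)"
  proof -
    define g where "g = (\<lambda>x. lam * exp x)"
    define Y where "Y = (g ^^ Suc k) (real r)"
    have "mono g" by (auto simp: g_def mono_def)
    then have "(g ^^ Suc k) (real q) \<le> Y" unfolding Y_def by (rule funpow_mono) (simp add: r_def)
    moreover have "lam * exp (Re ((f ^^ Suc k) z1)) \<le> 1 / (2 * real N')"
      using w(2) z1(2) by (auto simp: norm_f)
    \<comment> \<open>With m r = k + 1, \<open>n_exp\<close> makes |w| smaller than lam exp (-Y),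
      that is, the real part one step earlier is below -Y.\<close>
    moreover have "2 * lam * real N' > exp Y"
    proof -
      have "2 * lam * (real (n r) - 1) \<le> 2 * lam * real N'" using NN(3) by (intro mult_left_mono) auto
      moreover have "exp Y < 2 * lam * (real (n r) - 1)"
        using n_exp[of r] unfolding Y_def g_def k .
      ultimately show ?thesis by linarith
    qed
    have N'0: "real N' > 0" using NN(2) n(2) by simp
    have "exp (Re ((f ^^ Suc k) z1)) < exp (- Y)"
    proof -
      have "exp (Re ((f ^^ Suc k) z1)) \<le> 1 / (2 * lam * real N')"
        using \<open>lam * exp (Re ((f ^^ Suc k) z1)) \<le> 1 / (2 * real N')\<close> N'0 by (simp add: field_simps)
      also have "\<dots> < 1 / exp Y"
        using \<open>2 * lam * real N' > exp Y\<close> N'0 by (intro divide_strict_left_mono) auto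
      finally show ?thesis by (simp add: exp_minus inverse_eq_divide)
    qed
    ultimately show ?thesis by (simp add: g_def)
  qed
  ultimately show "\<exists>k\<ge>q. s (Suc k) = 0 \<and> (\<exists>z\<in>itin s. Re ((f ^^ k) z) \<le> 0) \<and>
     (\<exists>z\<in>itin s. Re ((f ^^ Suc k) z) < - ((\<lambda>x. lam * exp x) ^^ Suc k) (real q))"
    using kq sk z0(1) z1(1) by blast
qed

end

theorem theorem1:
  fixes lam :: real and t :: "nat \<Rightarrow> int list"
  assumes "lam > 1 / exp 1"
    and "\<And>m. \<exists>x\<in>set (t m). x \<noteq> 0"
  shows "\<exists>n :: nat \<Rightarrow> nat. let s = zero_padded_concat n t in
    (\<exists>\<gamma>. is_hair lam s \<gamma>) \<and>
    (\<forall>\<gamma>. is_hair lam s \<gamma> \<longrightarrow>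
       with_infinity (itin_set lam s) = with_infinity (closure (\<gamma> ` {0<..})) \<and>
       with_infinity (closure (\<gamma> ` {0<..})) = accumulation_set \<gamma>) \<and>
    indecomposable_continuum_in riemann_sphere (with_infinity (itin_set lam s))"
proof -
  interpret expo lam by unfold_locales (rule assms(1))
  \<comment> \<open>All starting positions \<open>m\<close> are treated, because the position of
    block \<open>q\<close> depends on the earlier lengths.\<close>
  have "\<exists>c. Suc N0 \<le> c \<and> (\<forall>x\<in>set (t q). \<bar>x\<bar> + 1 \<le> int c) \<and>
    2 * lam * (real c - 1) > exp (((\<lambda>x. lam * exp x) ^^ m) (real q))" for q m
  proof -
    obtain c :: nat where c: "real c > exp (((\<lambda>x. lam * exp x) ^^ m) (real q)) / (2 * lam)"
      using reals_Archimedean2 by blast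
    \<comment> \<open>A sum with one term for each of the three requirements; the sum of the |x|
      bounds every entry of the block.\<close>
    define d where "d = Suc N0 + Suc c + (\<Sum>x\<leftarrow>t q. nat \<bar>x\<bar>)"
    have "\<bar>x\<bar> + 1 \<le> int d" if "x \<in> set (t q)" for x
    proof -
      have "nat \<bar>x\<bar> \<le> (\<Sum>x\<leftarrow>t q. nat \<bar>x\<bar>)" using that by (intro member_le_sum_list) auto
      then show ?thesis by (simp add: d_def)
    qed
    moreover have "exp (((\<lambda>x. lam * exp x) ^^ m) (real q)) < 2 * lam * (real d - 1)"
    proof -
      have "exp (((\<lambda>x. lam * exp x) ^^ m) (real q)) < 2 * lam * real c"
        using c by (simp add: pos_divide_less_eq mult.commute)
      also have "\<dots> \<le> 2 * lam * (real d - 1)" by (intro mult_left_mono) (simp_all add: d_def)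
      finally show ?thesis .
    qed
    ultimately show ?thesis by (intro exI[of _ d]) (simp add: d_def)
  qed
  then obtain c where c: "\<And>q m. Suc N0 \<le> c q m" "\<And>q m x. x \<in> set (t q) \<Longrightarrow> \<bar>x\<bar> + 1 \<le> int (c q m)"
    "\<And>q m. 2 * lam * (real (c q m) - 1) > exp (((\<lambda>x. lam * exp x) ^^ m) (real q))"
    by metis
  \<comment> \<open>Positions are built recursively from the length \<open>c\<close> required at
    each position; \<open>n\<close> then reads off the lengths.\<close>
  define m where "m = rec_nat 0 (\<lambda>q k. k + c q k + length (t q))"
  define n where "n q = c q (m q)" for q
  interpret padded lam t n m
    by unfold_locales (use assms(2) c in \<open>auto simp: m_def n_def\<close>)
  show ?thesis
    unfolding Let_def by (rule exI[of _ n], rule good_itinerary[OF good_s long_gaps_s reaches_left_s, unfolded s_def])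
qed

end
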